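(* The following hold. (1) There exists $\gamma\in\mathbb R$ such that for all $i\in\mathcal I$, $\lim_{r\to0,\,r>0}r\,u^r_i=\gamma$. (2) There exists a sequence $(r_n)_{n\in\mathbb N}$ of positive reals converging to $0$ such that for all $i\in\mathcal I$ the sequence $(u^{r_n}_i-u^{r_n}_1)_{n\in\mathbb N}$ is convergent. (3) With such a sequence, if $\xi_i=\lim_{n\to+\infty}(u^{r_n}_i-u^{r_n}_1)$ for all $i\in\mathcal I$, then $$-\gamma+H\big(i,(\xi_j-\xi_i)_{j\in\mathcal V(i)}\big)=0,\qquad\forall i\in\mathcal I.$$
   Context: $\mathcal I=\{1,\dots,N\}$ is the set of nodes of a finite strongly connected directed graph $\mathcal G$ (for any two nodes $i,j$ there is a directed path from $i$ to $j$). For $i\in\mathcal I$, $\mathcal V(i)\subset\mathcal I\setminus\{i\}$ is the set of nodes $j$ for which there is a directed edge from $i$ to $j$. $\mathbb R_+=[0,\infty)$, $\mathbb R_+^*=(0,\infty)$. For each $i\in\mathcal I$ a cost function $L(i,\cdot):\mathbb R_+^{|\mathcal V(i)|}\to\mathbb R\cup\{+\infty\}$ is given, with: (A1) for every $i$ there is a tuple $(\lambda_{ij})_{j\in\mathcal V(i)}$ with all entries in $\mathbb R_+^*$ such that $L(i,(\lambda_{ij})_j)<+\infty$; (A2) each $L(i,\cdot)$ is lower semi-continuous; (A3) there is $\underline C\in\mathbb R$ with $L(i,\lambda)\ge\underline C$ for all $i$ and all $\lambda\in\mathbb R_+^{|\mathcal V(i)|}$; (A4) for every $i$, $L(i,\lambda)/\|\lambda\|_\infty\to+\infty$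 as $\|\lambda\|_\infty\to+\infty$. The Hamiltonian functions are $H(i,p)=\sup_{\lambda\in\mathbb R_+^{|\mathcal V(i)|}}\big(\sum_{j\in\mathcal V(i)}\lambda_{j}p_j-L(i,\lambda)\big)$ for $p\in\mathbb R^{|\mathcal V(i)|}$; they are real-valued. A terminal payoff $g:\mathcal I\to\mathbb R$ is fixed. All processes are defined on a filtered probability space satisfying the usual conditions and are adapted. For $0\le t\le T$, $\mathcal A^T_t$ is the set of families $(\lambda_s(i,j))_{s\in[t,T],i\in\mathcal I,j\in\mathcal V(i)}$ of non-negative deterministic functions with $s\mapsto\lambda_s(i,j)\in L^1(t,T)$ for all $i,j$. For $\lambda\in\mathcal A^T_t$, $(X^{t,i,\lambda}_s)_{s\in[t,T]}$ is the continuous-time Markov chain on $\mathcal I$ starting from node $i$ at time $t$ whose instantaneous transition rate at time $s$ from $k$ to $j\in\mathcal V(k)$ is $\lambda_s(k,j)$. For $r\ge0$, $$u^{T,r}_i(t)=\sup_{\lambda\in\mathcal A^T_t}\mathbb E\left[-\int_t^Te^{-r(s-t)}L\Big(X^{t,i,\lambda}_s,\big(\lambda_s(X^{t,i,\lambda}_s,j)\big)_{j\in\mathcal V(X^{t,i,\lambda}_s)}\Big)ds+e^{-r(T-t)}g\big(X^{t,i,\lambda}_T\big)\right].$$ For $r>0$ and $i\in\mathcal I$, $u^r_i=\lim_{T\to+\infty}u^{T,r}_i(t)\in\mathbb R$; this limit exists and does not depend on $t\in\mathbb R_+$. *)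

theory Defs
  imports "HOL-Probability.Probability"
begin

text \<open>
  A directed graph on the nodes \<open>{1..N}\<close> is given by its successor sets \<open>V i\<close>. A vector of
  \<open>\<real>\<^sub>+\<close> to the power \<open>\<bar>V i\<bar>\<close> is a function \<open>nat \<Rightarrow> real\<close> in
  \<open>V i \<rightarrow>\<^sub>E {0..}\<close>; the topology that this set inherits from the product topology of
  \<open>nat \<Rightarrow> real\<close> is the Euclidean one.
\<close>

definition strongly_connected_graph :: "nat \<Rightarrow> (nat \<Rightarrow> nat set) \<Rightarrow> bool" where
  "strongly_connected_graph N V \<longleftrightarrow>
     (\<forall>i\<in>{1..N}. V i \<subseteq> {1..N} - {i}) \<and>
     (\<forall>i\<in>{1..N}. \<forall>j\<in>{1..N}. (i, j) \<in> {(k, l). k \<in> {1..N} \<and> l \<in> V k}\<^sup>*)"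

definition rate_space :: "(nat \<Rightarrow> nat set) \<Rightarrow> nat \<Rightarrow> (nat \<Rightarrow> real) set" where
  "rate_space V i = V i \<rightarrow>\<^sub>E {0..}"

text \<open>The \<open>0\<close> is inserted to cover the one-node graph, whose only successor set is empty.\<close>

definition sup_norm :: "nat set \<Rightarrow> (nat \<Rightarrow> real) \<Rightarrow> real" where
  "sup_norm A x = Max (insert 0 ((\<lambda>j. \<bar>x j\<bar>) ` A))"

definition lsc_on :: "'a::topological_space set \<Rightarrow> ('a \<Rightarrow> ereal) \<Rightarrow> bool" where
  "lsc_on S f \<longleftrightarrow> (\<forall>x\<in>S. f x \<le> Liminf (at x within S) f)"

definition superlinear :: "(nat \<Rightarrow> nat set) \<Rightarrow> nat \<Rightarrow> ((nat \<Rightarrow> real) \<Rightarrow> ereal) \<Rightarrow> bool" where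
  "superlinear V i f \<longleftrightarrow>
     ((\<lambda>x. f x / ereal (sup_norm (V i) x)) \<longlongrightarrow> \<infinity>)
       (inf (filtercomap (sup_norm (V i)) at_top) (principal (rate_space V i)))"

definition hamiltonian ::
    "(nat \<Rightarrow> nat set) \<Rightarrow> (nat \<Rightarrow> (nat \<Rightarrow> real) \<Rightarrow> ereal) \<Rightarrow> nat \<Rightarrow> (nat \<Rightarrow> real) \<Rightarrow> ereal" where
  "hamiltonian V L i p = (SUP x\<in>rate_space V i. ereal (\<Sum>j\<in>V i. x j * p j) - L i x)"

text \<open>
  The Lebesgue integral of an extended real function, as the difference of the integrals of the
  positive and the negative part (\<open>e2ennreal\<close> maps negative numbers to \<open>0\<close>). Below it is only used
  where one of the two parts has a finite integral.
\<close>

definition ereal_integral :: "'a measure \<Rightarrow> ('a \<Rightarrow> ereal) \<Rightarrow> ereal" where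
  "ereal_integral M f =
     enn2ereal (\<integral>\<^sup>+ x. e2ennreal (f x) \<partial>M) - enn2ereal (\<integral>\<^sup>+ x. e2ennreal (- f x) \<partial>M)"

definition usual_conditions :: "'w measure \<Rightarrow> (real \<Rightarrow> 'w measure) \<Rightarrow> bool" where
  "usual_conditions M F \<longleftrightarrow>
     prob_space M \<and> complete_measure M \<and>
     (\<forall>s\<ge>0. subalgebra M (F s)) \<and>
     (\<forall>s\<ge>0. \<forall>u\<ge>s. sets (F s) \<subseteq> sets (F u)) \<and>
     (\<forall>s\<ge>0. sets (F s) = (\<Inter>u\<in>{s<..}. sets (F u))) \<and>
     null_sets M \<subseteq> sets (F 0)"

text \<open>A control \<open>l\<close> assigns to time \<open>s\<close> and edge \<open>(i, j)\<close> the rate \<open>l s i j\<close>.\<close>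

definition admissible ::
    "nat \<Rightarrow> (nat \<Rightarrow> nat set) \<Rightarrow> real \<Rightarrow> real \<Rightarrow> (real \<Rightarrow> nat \<Rightarrow> nat \<Rightarrow> real) set" where
  "admissible N V t T =
     {l. \<forall>i\<in>{1..N}. \<forall>j\<in>V i.
           (\<forall>s\<in>{t..T}. 0 \<le> l s i j) \<and> set_integrable lborel {t..T} (\<lambda>s. l s i j)}"

definition generator ::
    "(nat \<Rightarrow> nat set) \<Rightarrow> (real \<Rightarrow> nat \<Rightarrow> nat \<Rightarrow> real) \<Rightarrow> real \<Rightarrow> nat \<Rightarrow> nat \<Rightarrow> real" where
  "generator V l s k j =
     (if j = k then - (\<Sum>m\<in>V k. l s k m) else if j \<in> V k then l s k j else 0)"

text \<open>
  \<open>P s u k j\<close> is the probability to be in \<open>j\<close> at time \<open>u\<close> given that the chain is in \<open>k\<close> at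
  time \<open>s\<close>. Since the rates are only integrable in time, the Kolmogorov forward equation
  \<open>\<partial>P/\<partial>u = P Q\<close> is stated in integrated form; it determines \<open>P\<close> on \<open>{1..N}\<close>.
\<close>

definition transition_function ::
    "nat \<Rightarrow> (nat \<Rightarrow> nat set) \<Rightarrow> (real \<Rightarrow> nat \<Rightarrow> nat \<Rightarrow> real) \<Rightarrow> real \<Rightarrow> real
      \<Rightarrow> (real \<Rightarrow> real \<Rightarrow> nat \<Rightarrow> nat \<Rightarrow> real) \<Rightarrow> bool" where
  "transition_function N V l t T P \<longleftrightarrow>
     (\<forall>s\<in>{t..T}. \<forall>u\<in>{s..T}. \<forall>k\<in>{1..N}. \<forall>j\<in>{1..N}.
        ((\<lambda>v. \<Sum>m=1..N. P s v k m * generator V l v m j)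
           has_integral (P s u k j - of_bool (k = j))) {s..u})"

text \<open>
  \<open>X\<close> is an adapted cadlag Markov chain on the time interval \<open>[t, T]\<close>, started in \<open>i\<close>, with
  instantaneous transition rates \<open>l\<close>.
\<close>

definition markov_chain_with_rates ::
    "nat \<Rightarrow> (nat \<Rightarrow> nat set) \<Rightarrow> 'w measure \<Rightarrow> (real \<Rightarrow> 'w measure) \<Rightarrow> real \<Rightarrow> real \<Rightarrow> nat
      \<Rightarrow> (real \<Rightarrow> nat \<Rightarrow> nat \<Rightarrow> real) \<Rightarrow> (real \<Rightarrow> 'w \<Rightarrow> nat) \<Rightarrow> bool" where
  "markov_chain_with_rates N V M F t T i l X \<longleftrightarrow>
     (\<forall>s\<in>{t..T}. X s \<in> F s \<rightarrow>\<^sub>M count_space {1..N}) \<and>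
     (\<forall>w\<in>space M. \<forall>s\<in>{t..<T}. continuous (at_right s) (\<lambda>u. X u w)) \<and>
     (\<forall>w\<in>space M. \<forall>s\<in>{t<..T}. \<exists>k. ((\<lambda>u. X u w) \<longlongrightarrow> k) (at_left s)) \<and>
     (AE w in M. X t w = i) \<and>
     (\<exists>P. transition_function N V l t T P \<and>
        (\<forall>s\<in>{t..T}. \<forall>u\<in>{s..T}. \<forall>j\<in>{1..N}.
           AE w in M. real_cond_exp M (F s) (\<lambda>w'. of_bool (X u w' = j)) w = P s u (X s w) j))"

text \<open>
  In the remaining definitions \<open>X T t i l\<close> is the chain on \<open>[t, T]\<close> that starts in \<open>i\<close> and is
  controlled by \<open>l\<close>.
\<close>

definition payoff ::
    "(nat \<Rightarrow> nat set) \<Rightarrow> (nat \<Rightarrow> (nat \<Rightarrow> real) \<Rightarrow> ereal) \<Rightarrow> (nat \<Rightarrow> real) \<Rightarrow> 'w measure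
      \<Rightarrow> real \<Rightarrow> real \<Rightarrow> real \<Rightarrow> (real \<Rightarrow> nat \<Rightarrow> nat \<Rightarrow> real) \<Rightarrow> (real \<Rightarrow> 'w \<Rightarrow> nat) \<Rightarrow> ereal" where
  "payoff V L g M r t T l Y =
     ereal_integral M (\<lambda>w.
       - ereal_integral (restrict_space lborel {t..T})
           (\<lambda>s. ereal (exp (- r * (s - t))) * L (Y s w) (restrict (l s (Y s w)) (V (Y s w))))
       + ereal (exp (- r * (T - t)) * g (Y T w)))"

definition value_fun ::
    "nat \<Rightarrow> (nat \<Rightarrow> nat set) \<Rightarrow> (nat \<Rightarrow> (nat \<Rightarrow> real) \<Rightarrow> ereal) \<Rightarrow> (nat \<Rightarrow> real) \<Rightarrow> 'w measure
      \<Rightarrow> (real \<Rightarrow> real \<Rightarrow> nat \<Rightarrow> (real \<Rightarrow> nat \<Rightarrow> nat \<Rightarrow> real) \<Rightarrow> real \<Rightarrow> 'w \<Rightarrow> nat)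
      \<Rightarrow> real \<Rightarrow> real \<Rightarrow> nat \<Rightarrow> real \<Rightarrow> ereal" where
  "value_fun N V L g M X T r i t =
     (SUP l\<in>admissible N V t T. payoff V L g M r t T l (X T t i l))"

text \<open>The real number that is the limit as \<open>T \<rightarrow> \<infinity>\<close> of the value function at every time \<open>t\<close>.\<close>

definition stationary_value ::
    "nat \<Rightarrow> (nat \<Rightarrow> nat set) \<Rightarrow> (nat \<Rightarrow> (nat \<Rightarrow> real) \<Rightarrow> ereal) \<Rightarrow> (nat \<Rightarrow> real) \<Rightarrow> 'w measure
      \<Rightarrow> (real \<Rightarrow> real \<Rightarrow> nat \<Rightarrow> (real \<Rightarrow> nat \<Rightarrow> nat \<Rightarrow> real) \<Rightarrow> real \<Rightarrow> 'w \<Rightarrow> nat)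
      \<Rightarrow> real \<Rightarrow> nat \<Rightarrow> real" where
  "stationary_value N V L g M X r i =
     (THE c. \<forall>t\<ge>0. ((\<lambda>T. value_fun N V L g M X T r i t) \<longlongrightarrow> ereal c) at_top)"

end

theory Submission
  imports Defs
begin

text \<open>
  By Tonelli the payoff of a control depends only on the one-dimensional marginals of its chain, and
  these solve the forward equation. Hence, if \<open>v\<close> solves \<open>r v\<^sub>i = H(i, (v\<^sub>j - v\<^sub>i)\<^sub>j)\<close>, a
  discounted Dynkin formula shows that the value functions converge to \<open>v\<close> as \<open>T \<rightarrow> \<infinity>\<close>, so
  \<open>u\<^sup>r = v\<close>; such a \<open>v\<close> exists by Perron's method. Irreducibility bounds the oscillation of \<open>u\<^sup>r\<close>
  uniformly in \<open>r\<close>, so along a subsequence \<open>r u\<^sup>r\<close> and \<open>u\<^sup>r - u\<^sup>r(1)\<close> converge to a pair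
  \<open>(\<gamma>, \<xi>)\<close> that solves the ergodic equation. Comparing \<open>u\<^sup>r\<close> with \<open>\<xi>\<close> at the extremal nodes of
  \<open>u\<^sup>r - \<xi>\<close> gives \<open>\<bar>r u\<^sup>r(k) - \<gamma>\<bar> \<le> r D\<close> for all \<open>r\<close>, hence the convergence of the full family.
\<close>

section \<open>Joint measurability and calculus with a discount factor\<close>

text \<open>Time is rounded up to a grid of mesh \<open>1 / Suc n\<close>. The rounded process
  involves only countably many sections \<open>f s\<close>, each measurable, so it is jointly
  measurable. Rounding upwards makes right continuity enough for pointwise convergence.\<close>

lemma borel_measurable_right_continuous_process:
  fixes f :: "real \<Rightarrow> 'w \<Rightarrow> real"
  assumes "t \<le> T"
    and meas: "\<And>s. s \<in> {t..T} \<Longrightarrow> f s \<in> borel_measurable M"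
    and rc: "\<And>s w. s \<in> {t..<T} \<Longrightarrow> w \<in> space M \<Longrightarrow> continuous (at_right s) (\<lambda>u. f u w)"
  shows "(\<lambda>(s, w). f s w) \<in> borel_measurable (restrict_space lborel {t..T} \<Otimes>\<^sub>M M)"
proof (rule borel_measurable_LIMSEQ_real)
  \<comment> \<open>The clipping by \<open>max\<close> and \<open>min\<close> keeps the rounded time
    inside [t, T], the only place where sections are known to be measurable.\<close>
  define d where "d n k = max t (min T (real_of_int k / real (Suc n)))" for n k
  define c where "c n s = \<lceil>s * real (Suc n)\<rceil>" for n and s :: real
  show "(\<lambda>p. f (d n (c n (fst p))) (snd p)) \<in> borel_measurable (restrict_space lborel {t..T} \<Otimes>\<^sub>M M)" for n
  proof (rule measurable_compose_countable)
    show "(\<lambda>p. f (d n k) (snd p)) \<in> borel_measurable (restrict_space lborel {t..T} \<Otimes>\<^sub>M M)" for k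
      by (rule measurable_compose[OF measurable_snd meas]) (use \<open>t \<le> T\<close> in \<open>auto simp: d_def\<close>)
    have [measurable]: "(\<lambda>x. x) \<in> borel_measurable (restrict_space lborel {t..T})"
      by (rule measurable_restrict_space1) simp
    show "(\<lambda>p. c n (fst p)) \<in> (restrict_space lborel {t..T} \<Otimes>\<^sub>M M) \<rightarrow>\<^sub>M count_space UNIV"
      unfolding c_def by measurable
  qed
  fix p assume "p \<in> space (restrict_space lborel {t..T} \<Otimes>\<^sub>M M)"
  then obtain s w where p: "p = (s, w)" "s \<in> {t..T}" "w \<in> space M"
    by (auto simp: space_pair_measure space_restrict_space)
  have ge: "s \<le> real_of_int (c n s) / real (Suc n)"
    and le: "real_of_int (c n s) / real (Suc n) \<le> s + 1 / real (Suc n)" for n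
  proof -
    show "s \<le> real_of_int (c n s) / real (Suc n)"
      unfolding c_def by (subst pos_le_divide_eq) (auto simp del: of_nat_Suc)
    have "real_of_int (c n s) \<le> s * real (Suc n) + 1"
      unfolding c_def by (rule of_int_ceiling_le_add_one)
    then show "real_of_int (c n s) / real (Suc n) \<le> s + 1 / real (Suc n)"
      by (simp add: divide_simps)
  qed
  have dge: "s \<le> d n (c n s)" "d n (c n s) \<le> s + 1 / real (Suc n)" for n
    using ge[of n] le[of n] p(2) by (auto simp: d_def max_def min_def)
  have lim: "(\<lambda>n. d n (c n s)) \<longlonglongrightarrow> s"
  proof (rule tendsto_sandwich[where f="\<lambda>_. s" and h="\<lambda>n. s + 1 / real (Suc n)"])
    show "(\<lambda>n. s + 1 / real (Suc n)) \<longlonglongrightarrow> s"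
      using tendsto_add[OF tendsto_const[of s] LIMSEQ_inverse_real_of_nat] by (simp add: inverse_eq_divide)
  qed (use dge in auto)
  show "(\<lambda>n. f (d n (c n (fst p))) (snd p)) \<longlonglongrightarrow> (case p of (s, w) \<Rightarrow> f s w)"
  proof (cases "s = T")
    case True
    have "d n (c n s) = s" for n
      using dge(1)[of n] True \<open>t \<le> T\<close> by (auto simp: d_def max_def min_def)
    then show ?thesis by (simp add: p)
  next
    case False
    then have "continuous (at_right s) (\<lambda>u. f u w)"
      using rc[of s w] p by auto
    then have "continuous (at s within {s..}) (\<lambda>u. f u w)"
      by (metis at_within_Ici_at_right continuous_within tendsto_at_within_iff_tendsto_nhds continuous_at_imp_continuous_within)
    then show ?thesis
      using lim dge(1) unfolding p continuous_within_sequentially o_def by auto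
  qed
qed

lemma discount_factor_bound:
  fixes r :: real
  assumes "s \<in> {t..T}"
  shows "\<bar>exp (- r * (s - t))\<bar> \<le> exp (\<bar>r\<bar> * (T - t))"
proof -
  have "- r * (s - t) \<le> \<bar>r\<bar> * (s - t)" using assms by (intro mult_right_mono) auto
  also have "\<dots> \<le> \<bar>r\<bar> * (T - t)" using assms by (intro mult_left_mono) auto
  finally show ?thesis by simp
qed

text \<open>This is the product rule for \<open>exp (- r * (s - t)) * G s\<close> integrated over
  [t, T]. As \<open>G\<close> is only an indefinite Lebesgue integral of \<open>b\<close>,
  differentiation is replaced by Fubini on the triangle t \<le> x \<le> s \<le> T.\<close>

lemma discounted_fundamental_theorem:
  fixes b G :: "real \<Rightarrow> real"
  assumes "t \<le> T"
    and b: "integrable (restrict_space lborel {t..T}) b"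
    and G: "\<And>s. s \<in> {t..T} \<Longrightarrow>
      G s = G0 + (LINT x|restrict_space lborel {t..T}. of_bool (x \<le> s) * b x)"
  shows "(LINT s|restrict_space lborel {t..T}. exp (- r * (s - t)) * (b s - r * G s)) =
      exp (- r * (T - t)) * G T - G0"
proof -
  define B where "B = restrict_space lborel {t..T}"
  have spB: "space B = {t..T}" by (simp add: B_def space_restrict_space)
  interpret B: finite_measure B
    by (rule finite_measureI) (simp add: B_def emeasure_restrict_space space_restrict_space \<open>t \<le> T\<close>)
  interpret BB: pair_sigma_finite B B ..
  have id[measurable]: "(\<lambda>x. x) \<in> borel_measurable B"
    unfolding B_def by (rule measurable_restrict_space1) simp
  note b = b[folded B_def]
  have [measurable]: "b \<in> borel_measurable B" using b by simp
  define e where "e s = exp (- r * (s - t))" for s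
  have [measurable]: "e \<in> borel_measurable B" unfolding e_def by measurable
  have ebd: "\<bar>e s\<bar> \<le> exp (\<bar>r\<bar> * (T - t))" if "s \<in> {t..T}" for s
    unfolding e_def by (rule discount_factor_bound[OF that])
  have mult_e: "integrable B (\<lambda>s. e s * h s)" if "integrable B h" for h
    by (rule Bochner_Integration.integrable_bound[where f="\<lambda>s. exp (\<bar>r\<bar> * (T - t)) * h s"])
       (use that ebd in \<open>auto simp: abs_mult spB intro!: AE_I2 mult_right_mono\<close>)
  have int_exp: "(LINT s|B. r * e s * of_bool (x \<le> s)) = e x - e T" if "x \<in> {t..T}" for x
  proof -
    have "(LINT s|B. r * e s * of_bool (x \<le> s)) = (LINT s|lborel. indicator {x..T} s *\<^sub>R (r * e s))"
      unfolding B_def using that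
      by (subst integral_restrict_space) (auto intro!: Bochner_Integration.integral_cong simp: indicator_def)
    also have "\<dots> = (- e T) - (- e x)"
      using that unfolding e_def
      by (intro integral_FTC_atLeastAtMost)
         (auto intro!: derivative_eq_intros continuous_intros simp: has_real_derivative_iff_has_vector_derivative[symmetric])
    finally show ?thesis by simp
  qed
  \<comment> \<open>Integrating \<open>h\<close> over \<open>x\<close> first gives
    \<open>r * e s * (G s - G0)\<close>; integrating over \<open>s\<close> first gives
    \<open>(e x - e T) * b x\<close> by \<open>int_exp\<close>. Equating the two orders is the whole
    argument.\<close>
  define h where "h x s = r * e s * of_bool (x \<le> s) * b x" for x s
  have hint: "integrable (B \<Otimes>\<^sub>M B) (\<lambda>(x, s). h x s)"
  proof (rule BB.Fubini_integrable)
    show "(\<lambda>(x, s). h x s) \<in> borel_measurable (B \<Otimes>\<^sub>M B)"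
      unfolding h_def by measurable
    have bound: "norm (h x s) \<le> \<bar>r\<bar> * exp (\<bar>r\<bar> * (T - t)) * \<bar>b x\<bar>" if "s \<in> {t..T}" for x s
      using ebd[OF that] by (auto simp: h_def abs_mult mult_ac intro!: mult_mono)
    have hi: "integrable B (\<lambda>s. h x s)" if "x \<in> space B" for x
      by (rule B.integrable_const_bound[where B="\<bar>r\<bar> * exp (\<bar>r\<bar> * (T - t)) * \<bar>b x\<bar>"])
         (use bound in \<open>auto simp: spB intro!: AE_I2\<close>, unfold h_def, measurable)
    then show "AE x in B. integrable B (\<lambda>y. case (x, y) of (x, s) \<Rightarrow> h x s)"
      by (auto intro!: AE_I2)
    show "integrable B (\<lambda>x. LINT y|B. norm (case (x, y) of (x, s) \<Rightarrow> h x s))"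
    proof (rule Bochner_Integration.integrable_bound[where
          f="\<lambda>x. (\<bar>r\<bar> * exp (\<bar>r\<bar> * (T - t)) * (T - t)) * b x"])
      show "AE x in B. norm (LINT y|B. norm (case (x, y) of (x, s) \<Rightarrow> h x s))
          \<le> norm (\<bar>r\<bar> * exp (\<bar>r\<bar> * (T - t)) * (T - t) * b x)"
      proof (rule AE_I2)
        fix x assume x: "x \<in> space B"
        have "norm (LINT y|B. norm (h x y)) = (LINT y|B. norm (h x y))" by simp
        also have "\<dots> \<le> (LINT y|B. \<bar>r\<bar> * exp (\<bar>r\<bar> * (T - t)) * \<bar>b x\<bar>)"
          by (rule integral_mono) (use hi[OF x] bound in \<open>auto simp: spB\<close>)
        also have "\<dots> = (\<bar>r\<bar> * exp (\<bar>r\<bar> * (T - t)) * \<bar>b x\<bar>) * (T - t)"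
          using \<open>t \<le> T\<close> by (simp add: spB) (simp add: B_def measure_restrict_space)
        finally show "norm (LINT y|B. norm (case (x, y) of (x, s) \<Rightarrow> h x s))
          \<le> norm (\<bar>r\<bar> * exp (\<bar>r\<bar> * (T - t)) * (T - t) * b x)"
          using \<open>t \<le> T\<close> by (simp add: abs_mult mult_ac)
      qed
    qed (use b in \<open>auto simp: h_def\<close>)
  qed
  have Fub: "(LINT s|B. LINT x|B. h x s) = (LINT x|B. LINT s|B. h x s)"
    by (rule BB.Fubini_integral[OF hint])
  have snd: "integrable B (\<lambda>s. LINT x|B. h x s)" by (rule BB.integrable_snd[OF hint])
  have ein: "integrable B e"
    using mult_e[of "\<lambda>_. 1"] by simp
  have reG: "r * e s * G s = r * G0 * e s + (LINT x|B. h x s)" if "s \<in> {t..T}" for s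
  proof -
    have "(LINT x|B. h x s) = r * e s * (LINT x|B. of_bool (x \<le> s) * b x)"
      unfolding h_def by (subst integral_mult_right_zero[symmetric]) (simp add: mult_ac)
    then show ?thesis using G[OF that] by (simp add: B_def algebra_simps)
  qed
  have reGi: "integrable B (\<lambda>s. r * e s * G s)"
  proof (subst Bochner_Integration.integrable_cong[OF refl])
    show "integrable B (\<lambda>s. r * G0 * e s + (LINT x|B. h x s))"
      using snd ein by auto
  qed (use reG in \<open>auto simp: spB\<close>)
  have eb: "integrable B (\<lambda>s. e s * b s)" using mult_e[OF b] .
  have eq: "exp (- r * (s - t)) * (b s - r * G s) = e s * b s - r * e s * G s" for s
    by (simp add: e_def algebra_simps)
  have GT: "G T = G0 + (LINT x|B. b x)"
  proof -
    have "(LINT x|B. of_bool (x \<le> T) * b x) = (LINT x|B. b x)"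
      by (rule Bochner_Integration.integral_cong) (auto simp: spB)
    then show ?thesis using G[of T] \<open>t \<le> T\<close> by (simp add: B_def)
  qed
  have int_e: "r * (LINT s|B. e s) = 1 - e T"
  proof -
    have "(LINT s|B. r * e s * of_bool (t \<le> s)) = (LINT s|B. r * e s)"
      by (rule Bochner_Integration.integral_cong) (auto simp: spB)
    then show ?thesis using int_exp[of t] \<open>t \<le> T\<close> by (simp add: e_def)
  qed
  have "(LINT s|B. r * e s * G s) = (LINT s|B. r * G0 * e s + (LINT x|B. h x s))"
    by (rule Bochner_Integration.integral_cong) (use reG in \<open>auto simp: spB\<close>)
  also have "\<dots> = G0 * (1 - e T) + (LINT x|B. LINT s|B. h x s)"
    using snd ein by (simp add: Fub int_e[symmetric])
  also have "(LINT x|B. LINT s|B. h x s) = (LINT x|B. e x * b x - e T * b x)"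
  proof (rule Bochner_Integration.integral_cong)
    fix x assume "x \<in> space B"
    then show "(LINT s|B. h x s) = e x * b x - e T * b x"
      unfolding h_def integral_mult_left_zero using int_exp[of x]
      by (simp add: spB left_diff_distrib del: integral_mult_right_zero)
  qed simp
  also have "\<dots> = (LINT x|B. e x * b x) - e T * (LINT x|B. b x)"
    using eb b by simp
  finally have main: "(LINT s|B. r * e s * G s) =
      G0 * (1 - e T) + ((LINT x|B. e x * b x) - e T * (LINT x|B. b x))" .
  have "(LINT s|B. e s * b s - r * e s * G s) = (LINT s|B. e s * b s) - (LINT s|B. r * e s * G s)"
    by (rule Bochner_Integration.integral_diff[OF eb reGi])
  also have "\<dots> = e T * G T - G0"
    unfolding main GT by (simp add: algebra_simps)
  finally show "(LINT s|restrict_space lborel {t..T}. exp (- r * (s - t)) * (b s - r * G s)) =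
      exp (- r * (T - t)) * G T - G0"
    unfolding eq unfolding B_def[symmetric] e_def[symmetric] .
qed

section \<open>Marginals of a controlled chain and the Dynkin formula\<close>

lemma usual_conditions_subalgebra:
  assumes "usual_conditions M F" "0 \<le> s"
  shows "prob_space M" "subalgebra M (F s)"
  using assms by (auto simp: usual_conditions_def)

lemma chain_measurable:
  assumes "usual_conditions M F" "markov_chain_with_rates N V M F t T i l Y" "0 \<le> t" "s \<in> {t..T}"
  shows "Y s \<in> M \<rightarrow>\<^sub>M count_space {1..N}"
proof -
  have "Y s \<in> F s \<rightarrow>\<^sub>M count_space {1..N}"
    using assms by (auto simp: markov_chain_with_rates_def)
  moreover have "subalgebra M (F s)"
    using assms by (intro usual_conditions_subalgebra) auto
  ultimately show ?thesis
    by (rule measurable_from_subalg[rotated])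
qed

lemma chain_indicator_measurable:
  assumes "usual_conditions M F" "markov_chain_with_rates N V M F t T i l Y" "0 \<le> t" "s \<in> {t..T}"
  shows "(\<lambda>w. of_bool (Y s w = m) :: real) \<in> borel_measurable M"
  by (rule measurable_compose[OF chain_measurable[OF assms]]) simp

text \<open>The state space is discrete, so a right-continuous path stays constant for a short time
  after each s < T. The indicator of a state therefore inherits right continuity.\<close>

lemma chain_jointly_measurable:
  assumes u: "usual_conditions M F" and Y: "markov_chain_with_rates N V M F t T i l Y"
    and "0 \<le> t" "t \<le> T"
  shows "(\<lambda>(s, w). of_bool (Y s w = m) :: real) \<in> borel_measurable (restrict_space lborel {t..T} \<Otimes>\<^sub>M M)"
proof (rule borel_measurable_right_continuous_process[OF \<open>t \<le> T\<close>])
  show "continuous (at_right s) (\<lambda>u. of_bool (Y u w = m) :: real)"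
    if "s \<in> {t..<T}" "w \<in> space M" for s w
  proof -
    have "continuous (at_right s) (\<lambda>u. Y u w)"
      using Y that by (auto simp: markov_chain_with_rates_def)
    then have "eventually (\<lambda>u. Y u w = Y s w) (at_right s)"
      unfolding continuous_within by (simp add: tendsto_discrete)
    then have "eventually (\<lambda>u. (of_bool (Y s w = m) :: real) = of_bool (Y u w = m)) (at_right s)"
      by eventually_elim simp
    then show ?thesis
      unfolding continuous_within by (rule Lim_transform_eventually[OF tendsto_const])
  qed
qed (use chain_indicator_measurable[OF u Y \<open>0 \<le> t\<close>] in auto)

text \<open>Conditioning on the information at the initial time \<open>t\<close>, when the chain is
  almost surely in \<open>i\<close>, identifies the marginal law at a later time with row
  \<open>i\<close> of \<open>P t\<close>. The forward equation for that row is then an equation for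
  the marginals.\<close>

lemma chain_forward_equation:
  assumes u: "usual_conditions M F" and Y: "markov_chain_with_rates N V M F t T i l Y"
    and "0 \<le> t" "i \<in> {1..N}" "s \<in> {t..T}" "j \<in> {1..N}"
  shows "((\<lambda>x. \<Sum>m=1..N. (LINT w|M. of_bool (Y x w = m)) * generator V l x m j)
    has_integral ((LINT w|M. of_bool (Y s w = j)) - of_bool (i = j))) {t..s}"
proof -
  interpret prob_space M using usual_conditions_subalgebra[OF u, of 0] by simp
  interpret finite_measure_subalgebra M "F t"
    by standard (rule usual_conditions_subalgebra[OF u \<open>0 \<le> t\<close>])
  have tT: "t \<in> {t..T}" using \<open>s \<in> {t..T}\<close> by auto
  obtain P where P: "transition_function N V l t T P"
    and P_cond: "\<forall>s\<in>{t..T}. \<forall>u\<in>{s..T}. \<forall>j\<in>{1..N}.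
      AE w in M. real_cond_exp M (F s) (\<lambda>w'. of_bool (Y u w' = j)) w = P s u (Y s w) j"
    using Y unfolding markov_chain_with_rates_def by blast
  have cond: "AE w in M. real_cond_exp M (F t) (\<lambda>w'. of_bool (Y x w' = k)) w = P t x (Y t w) k"
    if "x \<in> {t..T}" "k \<in> {1..N}" for x k
    by (rule P_cond[rule_format, OF tT that])
  have start: "AE w in M. Y t w = i"
    using Y by (simp add: markov_chain_with_rates_def)
  have marg: "(LINT w|M. of_bool (Y x w = k)) = P t x i k" if "x \<in> {t..T}" "k \<in> {1..N}" for x k
  proof -
    have [measurable]: "(\<lambda>w. of_bool (Y x w = k) :: real) \<in> borel_measurable M"
      by (rule chain_indicator_measurable[OF u Y \<open>0 \<le> t\<close> that(1)])
    have "integrable M (\<lambda>w. of_bool (Y x w = k) :: real)"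
      by (rule integrable_const_bound[where B=1]) auto
    then have "(LINT w|M. of_bool (Y x w = k)) =
        (LINT w|M. real_cond_exp M (F t) (\<lambda>w'. of_bool (Y x w' = k)) w)"
      by (rule real_cond_exp_int(2)[symmetric])
    also have "\<dots> = (LINT w|M. P t x i k)"
      by (rule integral_cong_AE) (use cond[OF that] start in auto)
    finally show ?thesis by (simp add: prob_space)
  qed
  have "((\<lambda>x. \<Sum>m=1..N. P t x i m * generator V l x m j) has_integral (P t s i j - of_bool (i = j))) {t..s}"
    using P assms unfolding transition_function_def by auto
  then show ?thesis
    unfolding marg[OF \<open>s \<in> {t..T}\<close> \<open>j \<in> {1..N}\<close>]
    by (rule has_integral_eq[rotated]) (use marg \<open>s \<in> {t..T}\<close> in auto)
qed

lemma sum_generator: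
  assumes "m \<in> {1..N}" "V m \<subseteq> {1..N} - {m}"
  shows "(\<Sum>j=1..N. generator V l s m j * v j) = (\<Sum>j\<in>V m. l s m j * (v j - v m))"
proof -
  have fin: "finite (V m)" using assms(2) finite_subset by blast
  have "(\<Sum>j=1..N. generator V l s m j * v j) =
      - (\<Sum>j\<in>V m. l s m j) * v m + (\<Sum>j\<in>{1..N} - {m}. generator V l s m j * v j)"
    using assms(1) by (subst sum.remove[of _ m]) (auto simp: generator_def)
  also have "(\<Sum>j\<in>{1..N} - {m}. generator V l s m j * v j) = (\<Sum>j\<in>V m. l s m j * v j)"
    by (rule sum.mono_neutral_cong_right) (use assms in \<open>auto simp: generator_def\<close>)
  finally show ?thesis
    by (simp add: sum_distrib_right right_diff_distrib sum_subtractf sum_negf)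
qed

text \<open>Here \<open>a s m\<close> is the generator minus the discount rate, applied to
  \<open>v\<close> at node \<open>m\<close>. After splitting by states, Fubini moves the expectation
  inside the time integral, where only marginal probabilities remain; the forward equation and the
  discounted product rule then evaluate it.\<close>

lemma chain_dynkin:
  fixes v :: "nat \<Rightarrow> real" and r :: real
  assumes u: "usual_conditions M F" and Y: "markov_chain_with_rates N V M F t T i l Y"
    and t: "0 \<le> t" "t \<le> T" and i: "i \<in> {1..N}" and l: "l \<in> admissible N V t T"
    and V: "\<And>k. k \<in> {1..N} \<Longrightarrow> V k \<subseteq> {1..N} - {k}"
  defines "a \<equiv> \<lambda>s m. (\<Sum>j\<in>V m. l s m j * (v j - v m)) - r * v m"
  shows "\<And>w. w \<in> space M \<Longrightarrow>
      integrable (restrict_space lborel {t..T}) (\<lambda>s. exp (- r * (s - t)) * a s (Y s w))"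
    and "integrable M (\<lambda>w. LINT s|restrict_space lborel {t..T}. exp (- r * (s - t)) * a s (Y s w))"
    and "(LINT w|M. LINT s|restrict_space lborel {t..T}. exp (- r * (s - t)) * a s (Y s w)) =
      exp (- r * (T - t)) * (LINT w|M. v (Y T w)) - v i"
proof -
  define B where "B = restrict_space lborel {t..T}"
  have spB: "space B = {t..T}" by (simp add: B_def space_restrict_space)
  interpret B: finite_measure B
    by (rule finite_measureI) (simp add: B_def emeasure_restrict_space space_restrict_space t)
  interpret prob_space M using usual_conditions_subalgebra[OF u, of 0] by simp
  interpret BM: pair_sigma_finite B M ..
  have id[measurable]: "(\<lambda>x. x) \<in> borel_measurable B"
    unfolding B_def by (rule measurable_restrict_space1) simp
  define e where "e s = exp (- r * (s - t))" for s
  have [measurable]: "e \<in> borel_measurable B" unfolding e_def by measurable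
  have ebd: "\<bar>e s\<bar> \<le> exp (\<bar>r\<bar> * (T - t))" if "s \<in> {t..T}" for s
    unfolding e_def by (rule discount_factor_bound[OF that])
  have lint: "integrable B (\<lambda>s. l s m j)" if "m \<in> {1..N}" "j \<in> V m" for m j
    using l that unfolding B_def admissible_def set_integrable_def
    by (subst integrable_restrict_space) auto
  have aint: "integrable B (\<lambda>s. a s m)" if "m \<in> {1..N}" for m
    unfolding a_def using lint[OF that] by auto
  have YN: "Y s w \<in> {1..N}" if "s \<in> {t..T}" "w \<in> space M" for s w
    using measurable_space[OF chain_measurable[OF u Y t(1) that(1)] that(2)] by simp
  \<comment> \<open>Randomness now enters only through an indicator. The rates need not be bounded
    in time, so the dominating function is a multiple of the integrable \<open>a s m\<close> rather
    than a constant.\<close>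
  define \<phi> where "\<phi> s w m = e s * (of_bool (Y s w = m) * a s m)" for s w m
  have Ymeas: "(\<lambda>(s, w). of_bool (Y s w = m) :: real) \<in> borel_measurable (B \<Otimes>\<^sub>M M)" for m
    unfolding B_def by (rule chain_jointly_measurable[OF u Y t])
  have Ymeas': "(\<lambda>p. of_bool (Y (fst p) (snd p) = m) :: real) \<in> borel_measurable (B \<Otimes>\<^sub>M M)" for m
    using Ymeas[of m] by (simp add: case_prod_beta')
  have decomp: "e s * a s (Y s w) = (\<Sum>m=1..N. \<phi> s w m)" if "s \<in> {t..T}" "w \<in> space M" for s w
  proof -
    have "(\<Sum>m=1..N. \<phi> s w m) = (\<Sum>m=1..N. if Y s w = m then e s * a s m else 0)"
      by (rule sum.cong) (auto simp: \<phi>_def)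
    then show ?thesis using YN[OF that] by simp
  qed
  have phi_int: "integrable (B \<Otimes>\<^sub>M M) (\<lambda>(s, w). \<phi> s w m)" if m: "m \<in> {1..N}" for m
  proof (rule Bochner_Integration.integrable_bound)
    have [measurable]: "(\<lambda>s. a s m) \<in> borel_measurable B" using aint[OF m] by simp
    show "integrable (B \<Otimes>\<^sub>M M) (\<lambda>(s, w). exp (\<bar>r\<bar> * (T - t)) * a s m)"
    proof (rule BM.Fubini_integrable)
      show "integrable B (\<lambda>s. LINT w|M. norm (case (s, w) of (s, w) \<Rightarrow> exp (\<bar>r\<bar> * (T - t)) * a s m))"
        using aint[OF m] by (simp add: prob_space abs_mult)
    qed auto
    show "(\<lambda>(s, w). \<phi> s w m) \<in> borel_measurable (B \<Otimes>\<^sub>M M)"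
      unfolding \<phi>_def case_prod_beta'
      by (intro borel_measurable_times Ymeas') (auto intro: measurable_compose[OF measurable_fst])
    show "AE p in B \<Otimes>\<^sub>M M. norm (case p of (s, w) \<Rightarrow> \<phi> s w m)
        \<le> norm (case p of (s, w) \<Rightarrow> exp (\<bar>r\<bar> * (T - t)) * a s m)"
    proof (rule AE_I2)
      fix p assume "p \<in> space (B \<Otimes>\<^sub>M M)"
      then obtain s w where p: "p = (s, w)" "s \<in> {t..T}"
        by (auto simp: space_pair_measure spB)
      show "norm (case p of (s, w) \<Rightarrow> \<phi> s w m) \<le> norm (case p of (s, w) \<Rightarrow> exp (\<bar>r\<bar> * (T - t)) * a s m)"
        using ebd[OF p(2)] by (auto simp: p(1) \<phi>_def abs_mult intro!: mult_mono)
    qed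
  qed
  have sec_int: "integrable B (\<lambda>s. \<phi> s w m)" if m: "m \<in> {1..N}" and w: "w \<in> space M" for w m
  proof (rule Bochner_Integration.integrable_bound)
    have [measurable]: "(\<lambda>s. a s m) \<in> borel_measurable B" using aint[OF m] by simp
    have "(\<lambda>s. of_bool (Y s w = m) :: real) \<in> borel_measurable B"
      using measurable_compose[OF measurable_Pair2'[OF w] Ymeas[of m]] by simp
    then show "(\<lambda>s. \<phi> s w m) \<in> borel_measurable B"
      unfolding \<phi>_def by (intro borel_measurable_times) auto
    show "integrable B (\<lambda>s. exp (\<bar>r\<bar> * (T - t)) * a s m)"
      using aint[OF m] by auto
    show "AE s in B. norm (\<phi> s w m) \<le> norm (exp (\<bar>r\<bar> * (T - t)) * a s m)"
      using ebd by (auto simp: spB \<phi>_def abs_mult intro!: mult_mono AE_I2)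
  qed
  show "integrable (restrict_space lborel {t..T}) (\<lambda>s. exp (- r * (s - t)) * a s (Y s w))"
    if w: "w \<in> space M" for w
    unfolding B_def[symmetric] e_def[symmetric]
    by (subst Bochner_Integration.integrable_cong[OF refl decomp])
       (use sec_int w in \<open>auto simp: spB\<close>)
  have inner: "(LINT s|B. e s * a s (Y s w)) = (\<Sum>m=1..N. (LINT s|B. \<phi> s w m))" if w: "w \<in> space M" for w
    by (subst Bochner_Integration.integral_cong[OF refl decomp])
       (use sec_int w in \<open>auto simp: spB\<close>)
  have phi_int_M: "integrable M (\<lambda>w. LINT s|B. \<phi> s w m)" if "m \<in> {1..N}" for m
    by (rule BM.integrable_snd[OF phi_int[OF that]])
  show "integrable M (\<lambda>w. LINT s|restrict_space lborel {t..T}. exp (- r * (s - t)) * a s (Y s w))"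
    unfolding B_def[symmetric] e_def[symmetric]
    by (subst Bochner_Integration.integrable_cong[OF refl inner])
       (use phi_int_M in auto)
  define p :: "real \<Rightarrow> nat \<Rightarrow> real" where "p s m = (LINT w|M. of_bool (Y s w = m))" for s m
  have [measurable]: "(\<lambda>s. p s m) \<in> borel_measurable B" for m
    unfolding p_def by (rule borel_measurable_lebesgue_integral[OF Ymeas])
  have pbd: "\<bar>p s m\<bar> \<le> 1" if "s \<in> {t..T}" for s m
  proof -
    have "integrable M (\<lambda>w. of_bool (Y s w = m) :: real)"
      by (rule integrable_const_bound[where B=1])
         (use chain_indicator_measurable[OF u Y t(1) that] in auto)
    then have "p s m \<le> (LINT w|M. 1)" unfolding p_def by (intro integral_mono) auto
    moreover have "0 \<le> p s m" unfolding p_def by (rule integral_nonneg_AE) auto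
    ultimately show ?thesis by (simp add: prob_space)
  qed
  have pl: "integrable B (\<lambda>s. p s m * h s)" if "integrable B h" for h m
  proof (rule Bochner_Integration.integrable_bound[OF that])
    show "AE s in B. norm (p s m * h s) \<le> norm (h s)"
      using pbd by (auto simp: spB abs_mult intro!: AE_I2 mult_left_le_one_le)
  qed (use that in auto)
  \<comment> \<open>By the forward equation, \<open>q\<close> is the time density of the marginals
    \<open>p\<close>.\<close>
  define q where "q s j = (\<Sum>m=1..N. p s m * generator V l s m j)" for s j
  have qint: "integrable B (\<lambda>s. q s j)" for j
  proof -
    have "integrable B (\<lambda>s. generator V l s m j)" if "m \<in> {1..N}" for m
      using lint[OF that] unfolding generator_def by (cases "j = m"; cases "j \<in> V m") auto
    then show ?thesis unfolding q_def using pl by auto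
  qed
  have fwd: "p s j = of_bool (i = j) + (LINT x|B. of_bool (x \<le> s) * q x j)"
    if s: "s \<in> {t..T}" and j: "j \<in> {1..N}" for s j
  proof -
    \<comment> \<open>The forward equation is a gauge integral. Lebesgue integrability of
      \<open>q\<close>, already known from the integrable rates, allows it to be read as a Lebesgue
      integral.\<close>
    have "set_integrable lborel {t..T} (\<lambda>x. q x j)"
      using qint[of j] unfolding B_def set_integrable_def
      by (subst (asm) integrable_restrict_space) auto
    then have set: "set_integrable lborel {t..s} (\<lambda>x. q x j)"
      by (rule set_integrable_subset) (use s in auto)
    have "((\<lambda>x. q x j) has_integral (p s j - of_bool (i = j))) {t..s}"
      unfolding q_def p_def by (rule chain_forward_equation[OF u Y t(1) i s j])
    then have "p s j - of_bool (i = j) = (LINT x:{t..s}|lborel. q x j)"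
      unfolding set_borel_integral_eq_integral(2)[OF set] by (rule integral_unique[symmetric])
    also have "\<dots> = (LINT x|B. of_bool (x \<le> s) * q x j)"
      unfolding B_def set_lebesgue_integral_def using s
      by (subst integral_restrict_space)
         (auto intro!: Bochner_Integration.integral_cong simp: indicator_def)
    finally show ?thesis by simp
  qed
  define b where "b s = (\<Sum>m=1..N. p s m * (\<Sum>j\<in>V m. l s m j * (v j - v m)))" for s
  \<comment> \<open>Exchanging the sums over current and target node moves the generator from
    \<open>v\<close> to the marginals. Hence \<open>b\<close> is the density of the expectation
    \<open>G\<close> of \<open>v\<close> along the chain.\<close>
  have bq: "b s = (\<Sum>j=1..N. v j * q s j)" for s
  proof -
    have "b s = (\<Sum>m=1..N. p s m * (\<Sum>j=1..N. generator V l s m j * v j))"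
      unfolding b_def by (intro sum.cong refl) (subst sum_generator[OF _ V], auto)
    also have "\<dots> = (\<Sum>m=1..N. \<Sum>j=1..N. v j * (p s m * generator V l s m j))"
      by (simp add: sum_distrib_left mult_ac)
    also have "\<dots> = (\<Sum>j=1..N. v j * q s j)"
      unfolding q_def sum_distrib_left by (rule sum.swap)
    finally show ?thesis .
  qed
  have bint: "integrable B b" unfolding bq using qint by auto
  define G where "G s = (\<Sum>j=1..N. v j * p s j)" for s
  have GEq: "G s = v i + (LINT x|B. of_bool (x \<le> s) * b x)" if s: "s \<in> {t..T}" for s
  proof -
    have oq: "integrable B (\<lambda>x. of_bool (x \<le> s) * q x j)" for j
      by (rule Bochner_Integration.integrable_bound[OF qint[of j]])
         (use qint[of j] in \<open>auto intro!: AE_I2\<close>)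
    have "G s = (\<Sum>j=1..N. v j * of_bool (i = j)) + (\<Sum>j=1..N. v j * (LINT x|B. of_bool (x \<le> s) * q x j))"
      unfolding G_def sum.distrib[symmetric] using fwd[OF s]
      by (intro sum.cong refl) (auto simp: distrib_left)
    also have "(\<Sum>j=1..N. v j * of_bool (i = j)) = v i"
      using i by (simp add: of_bool_def if_distrib[of "\<lambda>x. _ * x"] cong: if_cong)
    also have "(\<Sum>j=1..N. v j * (LINT x|B. of_bool (x \<le> s) * q x j)) =
        (LINT x|B. (\<Sum>j=1..N. v j * (of_bool (x \<le> s) * q x j)))"
      using oq by (subst Bochner_Integration.integral_sum) auto
    also have "\<dots> = (LINT x|B. of_bool (x \<le> s) * b x)"
      unfolding bq by (simp add: sum_distrib_left mult_ac)
    finally show ?thesis .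
  qed
  have EG: "(LINT w|M. v (Y s w)) = G s" if s: "s \<in> {t..T}" for s
  proof -
    have ob: "integrable M (\<lambda>w. of_bool (Y s w = m) :: real)" for m
      by (rule integrable_const_bound[where B=1])
         (use chain_indicator_measurable[OF u Y t(1) s] in auto)
    have "(LINT w|M. v (Y s w)) = (LINT w|M. (\<Sum>m=1..N. v m * of_bool (Y s w = m)))"
      using YN[OF s] by (intro Bochner_Integration.integral_cong refl)
        (simp add: of_bool_def if_distrib[of "\<lambda>x. _ * x"] cong: if_cong)
    also have "\<dots> = G s"
      unfolding G_def p_def using ob by (subst Bochner_Integration.integral_sum) auto
    finally show ?thesis .
  qed
  have "(LINT w|M. LINT s|B. e s * a s (Y s w)) = (LINT w|M. (\<Sum>m=1..N. (LINT s|B. \<phi> s w m)))"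
    by (rule Bochner_Integration.integral_cong[OF refl inner])
  also have "\<dots> = (\<Sum>m=1..N. (LINT w|M. LINT s|B. \<phi> s w m))"
    using phi_int_M by (subst Bochner_Integration.integral_sum) auto
  also have "\<dots> = (\<Sum>m=1..N. (LINT s|B. LINT w|M. \<phi> s w m))"
    by (rule sum.cong[OF refl], rule BM.Fubini_integral[OF phi_int])
  also have "\<dots> = (\<Sum>m=1..N. (LINT s|B. e s * (p s m * a s m)))"
    unfolding \<phi>_def p_def by simp
  also have "\<dots> = (LINT s|B. (\<Sum>m=1..N. e s * (p s m * a s m)))"
  proof (rule Bochner_Integration.integral_sum[symmetric])
    fix m assume m: "m \<in> {1..N}"
    have "integrable B (\<lambda>s. LINT w|M. \<phi> s w m)"
      using BM.integrable_fst[OF phi_int[OF m]] by simp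
    then show "integrable B (\<lambda>s. e s * (p s m * a s m))"
      unfolding \<phi>_def p_def by simp
  qed
  also have "\<dots> = (LINT s|B. e s * (b s - r * G s))"
    by (rule Bochner_Integration.integral_cong[OF refl])
       (simp add: a_def b_def G_def sum_distrib_left sum_subtractf sum.distrib algebra_simps)
  also have "\<dots> = exp (- r * (T - t)) * G T - v i"
    unfolding e_def B_def
    by (rule discounted_fundamental_theorem) (use t bint GEq in \<open>auto simp: B_def\<close>)
  finally show "(LINT w|M. LINT s|restrict_space lborel {t..T}. exp (- r * (s - t)) * a s (Y s w)) =
      exp (- r * (T - t)) * (LINT w|M. v (Y T w)) - v i"
    unfolding B_def[symmetric] e_def[symmetric] using EG[of T] t by simp
qed

section \<open>Finite maxima and subsequences\<close>

lemma obtains_argmax: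
  fixes f :: "'a \<Rightarrow> real"
  assumes "finite A" "A \<noteq> {}"
  obtains i where "i \<in> A" "\<And>j. j \<in> A \<Longrightarrow> f j \<le> f i"
proof -
  have "Max (f ` A) \<in> f ` A" using assms by (intro Max_in) auto
  then obtain i where i: "i \<in> A" "Max (f ` A) = f i" by auto
  have "f j \<le> f i" if "j \<in> A" for j
    unfolding i(2)[symmetric] using assms(1) that by (intro Max_ge) auto
  with i(1) show ?thesis by (rule that)
qed

text \<open>One coordinate is treated at a time; passing to a further subsequence preserves the
  limits already obtained.\<close>

lemma finite_family_convergent_subsequence:
  fixes f :: "nat \<Rightarrow> 'a \<Rightarrow> real"
  assumes "finite A" "\<And>i. i \<in> A \<Longrightarrow> bounded (range (\<lambda>n. f n i))"
  shows "\<exists>s. strict_mono s \<and> (\<forall>i\<in>A. convergent (\<lambda>n. f (s n) i))"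
  using assms
proof (induction A rule: finite_induct)
  case empty
  show ?case by (intro exI[of _ id]) (simp add: strict_mono_def)
next
  case (insert a A)
  then obtain s where s: "strict_mono s" "\<forall>i\<in>A. convergent (\<lambda>n. f (s n) i)" by auto
  have "bounded (range (\<lambda>n. f (s n) a))"
    by (rule bounded_subset[OF insert.prems[of a]]) auto
  then obtain l s' where s': "strict_mono s'" "((\<lambda>n. f (s n) a) \<circ> s') \<longlonglongrightarrow> l"
    using bounded_imp_convergent_subsequence by blast
  have "convergent (\<lambda>n. f (s (s' n)) i)" if "i \<in> insert a A" for i
  proof (cases "i = a")
    case True
    then show ?thesis using s'(2) by (auto simp: o_def convergent_def)
  next
    case False
    then have "convergent ((\<lambda>n. f (s n) i) \<circ> s')"
      using s(2) s'(1) that by (intro convergent_subseq_convergent) auto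
    then show ?thesis by (simp add: o_def)
  qed
  moreover have "strict_mono (\<lambda>n. s (s' n))"
    using strict_mono_o[OF s(1) s'(1)] by (simp add: o_def)
  ultimately show ?case by blast
qed

section \<open>The Hamiltonian: finiteness, monotonicity, continuity\<close>

locale controlled_graph =
  fixes N :: nat and V :: "nat \<Rightarrow> nat set" and L :: "nat \<Rightarrow> (nat \<Rightarrow> real) \<Rightarrow> ereal"
  assumes nodes: "1 \<le> N"
    and graph: "strongly_connected_graph N V"
    and proper: "\<And>i. i \<in> {1..N} \<Longrightarrow> \<exists>x \<in> V i \<rightarrow>\<^sub>E {0<..}. L i x < \<infinity>"
    and bounded_below: "\<exists>C::real. \<forall>i\<in>{1..N}. \<forall>x\<in>rate_space V i. ereal C \<le> L i x"
    and superlin: "\<And>i. i \<in> {1..N} \<Longrightarrow> superlinear V i (L i)"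
begin

lemma V_subset: "i \<in> {1..N} \<Longrightarrow> V i \<subseteq> {1..N} - {i}"
  using graph by (simp add: strongly_connected_graph_def)

lemma V_finite: "i \<in> {1..N} \<Longrightarrow> finite (V i)"
  using V_subset finite_subset by blast

lemma L_not_MInf: "i \<in> {1..N} \<Longrightarrow> x \<in> rate_space V i \<Longrightarrow> L i x \<noteq> -\<infinity>"
  using bounded_below by (metis MInfty_neq_ereal(1) ereal_infty_less_eq(2))

text \<open>For rates of large norm the superlinear cost exceeds the linear gain, and for rates of
  bounded norm the lower bound on the cost applies. The strictly positive tuple of finite cost keeps
  the supremum away from -\<infinity>.\<close>

lemma hamiltonian_finite:
  assumes i: "i \<in> {1..N}"
  shows "\<bar>hamiltonian V L i p\<bar> \<noteq> \<infinity>"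
proof -
  obtain C :: real where C: "\<And>x. x \<in> rate_space V i \<Longrightarrow> ereal C \<le> L i x"
    using bounded_below i by blast
  define S where "S = (\<Sum>j\<in>V i. \<bar>p j\<bar>)"
  have S0: "0 \<le> S" by (simp add: S_def sum_nonneg)
  have "eventually (\<lambda>x. ereal S < L i x / ereal (sup_norm (V i) x))
      (inf (filtercomap (sup_norm (V i)) at_top) (principal (rate_space V i)))"
    using superlin[OF i] unfolding superlinear_def tendsto_PInfty by blast
  then obtain R where R: "\<And>x. sup_norm (V i) x \<ge> R \<Longrightarrow> x \<in> rate_space V i \<Longrightarrow>
      ereal S < L i x / ereal (sup_norm (V i) x)"
    unfolding eventually_inf_principal eventually_filtercomap_at_top_linorder by blast
  \<comment> \<open>The 0 serves the region of large norm, where the gain minus the cost is at most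
    0. The other term serves norms below \<open>max R 1\<close>; the 1 makes the norm positive in
    the first region, so the quotient by it can be cleared.\<close>
  define U where "U = max 0 (max R 1 * S - C)"
  have "ereal (\<Sum>j\<in>V i. x j * p j) - L i x \<le> ereal U"
    if x: "x \<in> rate_space V i" for x
  proof (cases "L i x")
    case (real c)
    define n where "n = sup_norm (V i) x"
    have xn: "\<bar>x j\<bar> \<le> n" if "j \<in> V i" for j
      unfolding n_def sup_norm_def using V_finite[OF i] that by (intro Max_ge) auto
    have n0: "0 \<le> n"
      unfolding n_def sup_norm_def using V_finite[OF i] by (intro Max_ge) auto
    have "(\<Sum>j\<in>V i. x j * p j) \<le> (\<Sum>j\<in>V i. n * \<bar>p j\<bar>)"
    proof (rule sum_mono)
      fix j assume "j \<in> V i"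
      have "x j * p j \<le> \<bar>x j\<bar> * \<bar>p j\<bar>" by (metis abs_ge_self abs_mult)
      also have "\<dots> \<le> n * \<bar>p j\<bar>" using xn[OF \<open>j \<in> V i\<close>] by (intro mult_right_mono) auto
      finally show "x j * p j \<le> n * \<bar>p j\<bar>" .
    qed
    then have le: "(\<Sum>j\<in>V i. x j * p j) \<le> n * S" by (simp add: S_def sum_distrib_left)
    show ?thesis
    proof (cases "max R 1 \<le> n")
      case True
      then have "S < c / n" using R[of x] x by (simp add: n_def real)
      then have "n * S \<le> c" using True by (simp add: divide_simps mult.commute split: if_splits)
      then have "(\<Sum>j\<in>V i. x j * p j) - c \<le> U" unfolding U_def using le by linarith
      then show ?thesis unfolding real by (simp only: ereal_minus ereal_less_eq)
    next
      case False
      then have "n * S \<le> max R 1 * S" using S0 by (intro mult_right_mono) auto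
      moreover have "C \<le> c" using C[OF x] by (simp add: real)
      ultimately have "(\<Sum>j\<in>V i. x j * p j) - c \<le> U" unfolding U_def using le by linarith
      then show ?thesis unfolding real by (simp only: ereal_minus ereal_less_eq)
    qed
  next
    case PInf
    then show ?thesis by simp
  next
    case MInf
    then show ?thesis using L_not_MInf[OF i x] by simp
  qed
  then have "hamiltonian V L i p \<le> ereal U"
    unfolding hamiltonian_def by (rule SUP_least)
  then have "hamiltonian V L i p \<noteq> \<infinity>" by auto
  moreover have "hamiltonian V L i p \<noteq> -\<infinity>"
  proof -
    obtain x where x: "x \<in> V i \<rightarrow>\<^sub>E {0<..}" "L i x < \<infinity>" using proper[OF i] by blast
    then have xr: "x \<in> rate_space V i"
      by (auto simp: rate_space_def PiE_iff less_imp_le)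
    then obtain c where "L i x = ereal c"
      using L_not_MInf[OF i] x by (cases "L i x") auto
    then have "ereal ((\<Sum>j\<in>V i. x j * p j) - c) \<le> hamiltonian V L i p"
      unfolding hamiltonian_def using xr by (intro SUP_upper2[of x]) auto
    then show ?thesis by auto
  qed
  ultimately show ?thesis by auto
qed

definition ham :: "nat \<Rightarrow> (nat \<Rightarrow> real) \<Rightarrow> real" where
  "ham i p = real_of_ereal (hamiltonian V L i p)"

lemma hamiltonian_eq: "i \<in> {1..N} \<Longrightarrow> hamiltonian V L i p = ereal (ham i p)"
  using hamiltonian_finite by (simp add: ham_def ereal_real)

lemma ham_ge:
  assumes "i \<in> {1..N}" "x \<in> rate_space V i" "L i x = ereal c"
  shows "(\<Sum>j\<in>V i. x j * p j) - c \<le> ham i p"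
proof -
  have "ereal ((\<Sum>j\<in>V i. x j * p j) - c) \<le> hamiltonian V L i p"
    unfolding hamiltonian_def using assms by (intro SUP_upper2[of x]) auto
  then show ?thesis using assms(1) by (simp add: hamiltonian_eq)
qed

text \<open>A tuple whose net gain exceeds a real number cannot have infinite cost, so each
  near-maximiser comes with a real cost \<open>c\<close>.\<close>

lemma ham_approx:
  assumes "i \<in> {1..N}" "0 < e"
  obtains x c where "x \<in> rate_space V i" "L i x = ereal c" "ham i p - e < (\<Sum>j\<in>V i. x j * p j) - c"
proof -
  have "ereal (ham i p - e) < hamiltonian V L i p"
    using assms by (simp add: hamiltonian_eq)
  then obtain x where x: "x \<in> rate_space V i" "ereal (ham i p - e) < ereal (\<Sum>j\<in>V i. x j * p j) - L i x"
    unfolding hamiltonian_def less_SUP_iff by blast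
  then obtain c where "L i x = ereal c"
    using L_not_MInf[OF assms(1)] by (cases "L i x") auto
  with x that show ?thesis by auto
qed

text \<open>Rates are non-negative, so a near-maximiser for \<open>p\<close> gains at least as much
  against \<open>q\<close>. This is the source of every comparison argument below.\<close>

lemma ham_mono:
  assumes i: "i \<in> {1..N}" and "\<And>j. j \<in> V i \<Longrightarrow> p j \<le> q j"
  shows "ham i p \<le> ham i q"
proof (rule field_le_epsilon)
  fix e :: real assume "0 < e"
  obtain x c where x: "x \<in> rate_space V i" "L i x = ereal c" "ham i p - e < (\<Sum>j\<in>V i. x j * p j) - c"
    by (rule ham_approx[OF i \<open>0 < e\<close>])
  have "(\<Sum>j\<in>V i. x j * p j) \<le> (\<Sum>j\<in>V i. x j * q j)"
    using assms(2) x(1) by (intro sum_mono mult_left_mono) (auto simp: rate_space_def PiE_iff)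
  then show "ham i p \<le> ham i q + e" using ham_ge[OF i x(1,2), of q] x(3) by linarith
qed

text \<open>Along the diagonal the Hamiltonian is a real-valued supremum of affine functions of
  \<open>x\<close>, hence convex on the line, hence continuous.\<close>

lemma ham_shift_continuous:
  assumes i: "i \<in> {1..N}"
  shows "continuous_on UNIV (\<lambda>x. ham i (\<lambda>j. p j + x))"
proof (rule convex_on_continuous)
  show "convex_on UNIV (\<lambda>x. ham i (\<lambda>j. p j + x))"
  proof (rule convex_onI)
    fix s x y :: real assume s: "0 < s" "s < 1"
    show "ham i (\<lambda>j. p j + ((1 - s) *\<^sub>R x + s *\<^sub>R y))
        \<le> (1 - s) * ham i (\<lambda>j. p j + x) + s * ham i (\<lambda>j. p j + y)"
    proof (rule field_le_epsilon)
      fix e :: real assume "0 < e"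
      obtain z c where z: "z \<in> rate_space V i" "L i z = ereal c"
        "ham i (\<lambda>j. p j + ((1 - s) * x + s * y)) - e < (\<Sum>j\<in>V i. z j * (p j + ((1 - s) * x + s * y))) - c"
        by (rule ham_approx[OF i \<open>0 < e\<close>])
      have "(\<Sum>j\<in>V i. z j * (p j + ((1 - s) * x + s * y))) - c =
          (1 - s) * ((\<Sum>j\<in>V i. z j * (p j + x)) - c) + s * ((\<Sum>j\<in>V i. z j * (p j + y)) - c)"
      proof -
        have "(\<Sum>j\<in>V i. z j * (p j + ((1 - s) * x + s * y))) =
          (1 - s) * (\<Sum>j\<in>V i. z j * (p j + x)) + s * (\<Sum>j\<in>V i. z j * (p j + y))"
          unfolding sum_distrib_left sum.distrib[symmetric]
          by (rule sum.cong) (auto simp: algebra_simps)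
        then show ?thesis by (simp add: algebra_simps)
      qed
      also have "\<dots> \<le> (1 - s) * ham i (\<lambda>j. p j + x) + s * ham i (\<lambda>j. p j + y)"
        using ham_ge[OF i z(1,2)] s by (intro add_mono mult_left_mono) auto
      finally show "ham i (\<lambda>j. p j + ((1 - s) *\<^sub>R x + s *\<^sub>R y))
        \<le> (1 - s) * ham i (\<lambda>j. p j + x) + s * ham i (\<lambda>j. p j + y) + e"
        using z(3) by simp
    qed
  qed simp
qed simp

text \<open>Monotonicity reduces continuity in several variables to continuity along the diagonal.\<close>

lemma ham_tendsto:
  assumes i: "i \<in> {1..N}" and q: "\<And>j. j \<in> V i \<Longrightarrow> ((\<lambda>n. q n j) \<longlongrightarrow> p j) G"
  shows "((\<lambda>n. ham i (q n)) \<longlongrightarrow> ham i p) G"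
proof (rule tendstoI)
  fix e :: real assume "0 < e"
  have "isCont (\<lambda>x. ham i (\<lambda>j. p j + x)) 0"
    using ham_shift_continuous[OF i, of p] by (simp add: continuous_on_eq_continuous_at)
  then have "(\<lambda>x. ham i (\<lambda>j. p j + x)) \<midarrow>0\<rightarrow> ham i (\<lambda>j. p j + 0)"
    by (simp only: isCont_def)
  from LIM_D[OF this \<open>0 < e\<close>] obtain d where d: "0 < d"
    and d': "\<forall>x. x \<noteq> 0 \<and> norm (x - 0) < d \<longrightarrow> norm (ham i (\<lambda>j. p j + x) - ham i (\<lambda>j. p j + 0)) < e"
    by auto
  \<comment> \<open>Once every \<open>q n j\<close> is within \<open>d / 2\<close> of
    \<open>p j\<close>, monotonicity traps \<open>ham i (q n)\<close> between these two shifted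
    values.\<close>
  have up: "\<bar>ham i (\<lambda>j. p j + d / 2) - ham i p\<bar> < e" and lo: "\<bar>ham i (\<lambda>j. p j + - d / 2) - ham i p\<bar> < e"
    using d d'[rule_format, of "d / 2"] d'[rule_format, of "- d / 2"] by simp_all
  have "eventually (\<lambda>n. \<forall>j\<in>V i. dist (q n j) (p j) < d / 2) G"
    by (intro eventually_ball_finite V_finite[OF i] ballI tendstoD[OF q]) (use d in auto)
  then show "eventually (\<lambda>n. dist (ham i (q n)) (ham i p) < e) G"
  proof eventually_elim
    case (elim n)
    then have qp: "q n j \<le> p j + d / 2" "p j + - d / 2 \<le> q n j" if "j \<in> V i" for j
      using bspec[OF elim that] unfolding dist_real_def by linarith+
    have "ham i (q n) \<le> ham i (\<lambda>j. p j + d / 2)"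
      by (rule ham_mono[OF i qp(1)])
    moreover have "ham i (\<lambda>j. p j + - d / 2) \<le> ham i (q n)"
      by (rule ham_mono[OF i qp(2)])
    ultimately show ?case using up lo unfolding dist_real_def by linarith
  qed
qed

section \<open>The discounted stationary equation\<close>

definition stationary_subsolution :: "real \<Rightarrow> (nat \<Rightarrow> real) \<Rightarrow> bool" where
  "stationary_subsolution r w \<longleftrightarrow> (\<forall>i\<in>{1..N}. r * w i \<le> ham i (\<lambda>j. w j - w i))"

definition stationary_solution :: "real \<Rightarrow> (nat \<Rightarrow> real) \<Rightarrow> bool" where
  "stationary_solution r v \<longleftrightarrow> (\<forall>i\<in>{1..N}. r * v i = ham i (\<lambda>j. v j - v i))"

definition ham_zero_bound :: real where
  "ham_zero_bound = Max ((\<lambda>i. \<bar>ham i (\<lambda>_. 0)\<bar>) ` {1..N})"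

lemma ham_zero_le: "i \<in> {1..N} \<Longrightarrow> \<bar>ham i (\<lambda>_. 0)\<bar> \<le> ham_zero_bound"
  unfolding ham_zero_bound_def by (intro Max_ge) auto

text \<open>At a node where \<open>w\<close> is maximal all differences are at most 0, so
  monotonicity bounds the Hamiltonian there by its value at 0. The bound does not depend on
  \<open>r\<close>.\<close>

lemma stationary_subsolution_le:
  assumes "stationary_subsolution r w" "0 < r" "i \<in> {1..N}"
  shows "r * w i \<le> ham_zero_bound"
proof -
  obtain k where k: "k \<in> {1..N}" "\<And>j. j \<in> {1..N} \<Longrightarrow> w j \<le> w k"
    using obtains_argmax[of "{1..N}" w] nodes by auto
  have "r * w i \<le> r * w k" using k assms by simp
  also have "\<dots> \<le> ham k (\<lambda>j. w j - w k)" using assms k by (simp add: stationary_subsolution_def)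
  also have "\<dots> \<le> ham k (\<lambda>_. 0)" using k V_subset[OF k(1)] by (intro ham_mono[OF k(1)]) auto
  also have "\<dots> \<le> ham_zero_bound" using ham_zero_le[OF k(1)] by simp
  finally show ?thesis .
qed

text \<open>The lower bound mirrors the previous argument at a node where \<open>v\<close> is
  minimal.\<close>

lemma stationary_solution_bound:
  assumes v: "stationary_solution r v" and "0 < r" "i \<in> {1..N}"
  shows "\<bar>r * v i\<bar> \<le> ham_zero_bound"
proof -
  obtain k where k: "k \<in> {1..N}" "\<And>j. j \<in> {1..N} \<Longrightarrow> - v j \<le> - v k"
    using obtains_argmax[of "{1..N}" "\<lambda>j. - v j"] nodes by auto
  have "- ham_zero_bound \<le> ham k (\<lambda>_. 0)" using ham_zero_le[OF k(1)] by simp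
  also have "\<dots> \<le> ham k (\<lambda>j. v j - v k)" using k V_subset[OF k(1)] by (intro ham_mono[OF k(1)]) auto
  also have "\<dots> = r * v k" using v k by (simp add: stationary_solution_def)
  also have "\<dots> \<le> r * v i" using k assms by simp
  finally show ?thesis
    using stationary_subsolution_le[of r v i] assms
    by (auto simp: stationary_subsolution_def stationary_solution_def abs_le_iff)
qed

text \<open>Perron's method: the pointwise supremum of all subsolutions is a solution.\<close>

lemma stationary_solution_exists:
  assumes r: "0 < r"
  shows "\<exists>v. stationary_solution r v"
proof -
  define S where "S = {w. stationary_subsolution r w}"
  define v where "v i = Sup ((\<lambda>w. w i) ` S)" for i
  \<comment> \<open>For a constant function the Hamiltonian is evaluated at 0, and this constant is
    low enough at every node.\<close>
  have "(\<lambda>_. - ham_zero_bound / r) \<in> S"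
    unfolding S_def stationary_subsolution_def using ham_zero_le r by (fastforce simp: abs_le_iff)
  then have ne: "S \<noteq> {}" by auto
  have bdd: "bdd_above ((\<lambda>w. w i) ` S)" if "i \<in> {1..N}" for i
    using stationary_subsolution_le[OF _ r that] r unfolding S_def
    by (intro bdd_aboveI[of _ "ham_zero_bound / r"]) (auto simp: pos_le_divide_eq mult.commute)
  have le_v: "w i \<le> v i" if "w \<in> S" "i \<in> {1..N}" for w i
    unfolding v_def using that bdd by (intro cSup_upper) auto
  \<comment> \<open>Since \<open>i\<close> is not its own successor, the value at \<open>i\<close>
    can vary while the successor values stay fixed. A strict inequality in the equation at
    \<open>i\<close> survives small changes of this kind.\<close>
  have close: "\<exists>d>0. \<forall>x. \<bar>x - v i\<bar> < d \<longrightarrow> ham i (\<lambda>j. v j - x) - r * x \<in> U"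
    if "i \<in> {1..N}" "open U" "ham i (\<lambda>j. v j - v i) - r * v i \<in> U" for i U
  proof -
    have "continuous_on UNIV ((\<lambda>x. ham i (\<lambda>j. v j + x)) \<circ> uminus)"
      by (intro continuous_on_compose continuous_intros continuous_on_subset[OF ham_shift_continuous[OF that(1)]]) auto
    then have "continuous_on UNIV (\<lambda>x. ham i (\<lambda>j. v j - x) - r * x)"
      by (intro continuous_intros) (simp add: o_def)
    then have "open ((\<lambda>x. ham i (\<lambda>j. v j - x) - r * x) -` U)"
      using that(2) by (simp add: open_vimage)
    then show ?thesis
      using that(3) unfolding open_dist dist_real_def by auto
  qed
  have sub: "r * v i \<le> ham i (\<lambda>j. v j - v i)" if i: "i \<in> {1..N}" for i
  proof (rule ccontr)
    assume "\<not> ?thesis"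
    then obtain d where d: "d > 0" "\<And>x. \<bar>x - v i\<bar> < d \<Longrightarrow> ham i (\<lambda>j. v j - x) - r * x < 0"
      using close[OF i, of "{..<0}"] by auto
    have "v i - d < Sup ((\<lambda>w. w i) ` S)" using d by (simp add: v_def)
    \<comment> \<open>A subsolution that nearly attains the supremum at \<open>i\<close> lies below
      \<open>v\<close> elsewhere, so monotonicity transfers its inequality to the values of
      \<open>v\<close> and contradicts the strict failure near \<open>v i\<close>.\<close>
    then obtain w where w: "w \<in> S" "v i - d < w i"
      using less_cSupD[of "(\<lambda>w. w i) ` S"] ne by auto
    have "r * w i \<le> ham i (\<lambda>j. w j - w i)"
      using w i by (simp add: S_def stationary_subsolution_def)
    also have "\<dots> \<le> ham i (\<lambda>j. v j - w i)"
      using le_v[OF w(1)] V_subset[OF i] by (intro ham_mono[OF i]) auto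
    also have "\<dots> < r * w i"
      using d(2)[of "w i"] w le_v[OF w(1) i] by auto
    finally show False by simp
  qed
  have "ham i (\<lambda>j. v j - v i) \<le> r * v i" if i: "i \<in> {1..N}" for i
  proof (rule ccontr)
    assume "\<not> ?thesis"
    then obtain d where d: "d > 0" "\<And>x. \<bar>x - v i\<bar> < d \<Longrightarrow> 0 < ham i (\<lambda>j. v j - x) - r * x"
      using close[OF i, of "{0<..}"] by auto
    \<comment> \<open>If the inequality is strict at \<open>i\<close>, raising \<open>v\<close>
      there alone still gives a subsolution: \<open>d\<close> protects node \<open>i\<close>, and at
      the other nodes the Hamiltonian can only grow. This contradicts the maximality of
      \<open>v i\<close>.\<close>
    define w where "w = v(i := v i + d / 2)"
    have "r * w k \<le> ham k (\<lambda>j. w j - w k)" if k: "k \<in> {1..N}" for k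
    proof (cases "k = i")
      case True
      have "ham i (\<lambda>j. v j - (v i + d / 2)) \<le> ham i (\<lambda>j. w j - w i)"
        using V_subset[OF i] by (intro ham_mono[OF i]) (auto simp: w_def)
      moreover have "r * w i \<le> ham i (\<lambda>j. v j - (v i + d / 2))"
        using d(2)[of "v i + d / 2"] d(1) by (simp add: w_def)
      ultimately show ?thesis using True by simp
    next
      case False
      then have "ham k (\<lambda>j. v j - v k) \<le> ham k (\<lambda>j. w j - w k)"
        using d(1) by (intro ham_mono[OF k]) (auto simp: w_def)
      then show ?thesis using sub[OF k] False by (simp add: w_def)
    qed
    then have "w \<in> S" by (simp add: S_def stationary_subsolution_def)
    then have "w i \<le> v i" using i by (rule le_v)
    then show False using d(1) by (simp add: w_def)
  qed
  with sub have "stationary_solution r v"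
    unfolding stationary_solution_def by (auto intro: antisym)
  then show ?thesis by blast
qed

section \<open>Uniform oscillation bound and the vanishing discount limit\<close>

text \<open>Testing the Hamiltonian with fixed positive rates bounds a weighted sum of the
  increments of \<open>v\<close> from above, uniformly in \<open>r\<close>. Starting at a minimum of
  \<open>v\<close>, this bound propagates along directed paths, and strong connectivity reaches
  every node.\<close>

lemma stationary_solution_oscillation:
  "\<exists>D. \<forall>r v. 0 < r \<longrightarrow> stationary_solution r v \<longrightarrow> (\<forall>i\<in>{1..N}. \<forall>k\<in>{1..N}. v k - v i \<le> D)"
proof -
  have "\<forall>i\<in>{1..N}. \<exists>x c. x \<in> V i \<rightarrow>\<^sub>E {0<..} \<and> L i x = ereal c"
  proof
    fix i assume i: "i \<in> {1..N}"
    obtain x where x: "x \<in> V i \<rightarrow>\<^sub>E {0<..}" "L i x < \<infinity>" using proper[OF i] by blast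
    then have "x \<in> rate_space V i" by (auto simp: rate_space_def PiE_iff less_imp_le)
    then show "\<exists>x c. x \<in> V i \<rightarrow>\<^sub>E {0<..} \<and> L i x = ereal c"
      using x L_not_MInf[OF i] by (cases "L i x") auto
  qed
  then obtain x c where x: "\<And>i. i \<in> {1..N} \<Longrightarrow> x i \<in> V i \<rightarrow>\<^sub>E {0<..}"
    and c: "\<And>i. i \<in> {1..N} \<Longrightarrow> L i (x i) = ereal (c i)"
    by metis
  have gen: "(\<Sum>j\<in>V i. x i j * (v j - v i)) \<le> ham_zero_bound + c i"
    if "0 < r" "stationary_solution r v" and i: "i \<in> {1..N}" for r v i
  proof -
    have "x i \<in> rate_space V i" using x[OF i] by (auto simp: rate_space_def PiE_iff less_imp_le)
    then have "(\<Sum>j\<in>V i. x i j * (v j - v i)) - c i \<le> ham i (\<lambda>j. v j - v i)"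
      using c[OF i] by (rule ham_ge[OF i])
    also have "\<dots> \<le> ham_zero_bound"
      using stationary_solution_bound[OF that(2,1) i] that(2) i by (simp add: stationary_solution_def)
    finally show ?thesis by simp
  qed
  \<comment> \<open>The constant \<open>d\<close> is chosen before \<open>r\<close> and
    \<open>v\<close>; it may depend on the path but not on the solution.\<close>
  have path: "k \<in> {1..N} \<and> (\<exists>d\<ge>0. \<forall>r v. 0 < r \<longrightarrow> stationary_solution r v \<longrightarrow>
      (\<forall>j\<in>{1..N}. v i \<le> v j) \<longrightarrow> v k \<le> v i + d)"
    if "(i, k) \<in> {(k, l). k \<in> {1..N} \<and> l \<in> V k}\<^sup>*" "i \<in> {1..N}" for i k
    using that
  proof (induction rule: rtrancl_induct)
    case base
    then show ?case by auto
  next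
    case (step k l)
    then have k: "k \<in> {1..N}" "l \<in> V k" by auto
    from step obtain d where d: "0 \<le> d" and dv: "\<And>r v. 0 < r \<Longrightarrow> stationary_solution r v \<Longrightarrow>
      (\<forall>j\<in>{1..N}. v i \<le> v j) \<Longrightarrow> v k \<le> v i + d" by blast
    have pos: "0 < x k j" if "j \<in> V k" for j using x[OF k(1)] that by (auto simp: PiE_iff)
    \<comment> \<open>The quotient bounds \<open>v l - v k\<close>, and dividing by
      \<open>x k l\<close> is possible because the test rates are strictly positive. The absolute
      value keeps \<open>d'\<close> non-negative for the next edge.\<close>
    define d' where "d' = d + \<bar>(ham_zero_bound + c k + d * (\<Sum>j\<in>V k. x k j)) / x k l\<bar>"
    have "v l \<le> v i + d'"
      if v: "0 < r" "stationary_solution r v" "\<forall>j\<in>{1..N}. v i \<le> v j" for r v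
    proof -
      have vk: "v k \<le> v i + d" using dv[OF v] .
      \<comment> \<open>The remaining increments cannot be very negative: each \<open>v j\<close> is
        at least the minimum \<open>v i\<close>, which is at least \<open>v k - d\<close>.\<close>
      have "(\<Sum>j\<in>V k - {l}. x k j * (- d)) \<le> (\<Sum>j\<in>V k - {l}. x k j * (v j - v k))"
      proof (intro sum_mono mult_left_mono)
        fix j assume j: "j \<in> V k - {l}"
        then have "v i \<le> v j" using V_subset[OF k(1)] v(3) by auto
        then show "- d \<le> v j - v k" using vk by simp
        show "0 \<le> x k j" using pos j by (simp add: less_imp_le)
      qed
      moreover have "(\<Sum>j\<in>V k. x k j * (v j - v k)) =
          x k l * (v l - v k) + (\<Sum>j\<in>V k - {l}. x k j * (v j - v k))"
        using V_finite[OF k(1)] k(2) by (rule sum.remove)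
      moreover have "(\<Sum>j\<in>V k - {l}. x k j * (- d)) \<ge> - (d * (\<Sum>j\<in>V k. x k j))"
      proof -
        have "(\<Sum>j\<in>V k. x k j) = x k l + (\<Sum>j\<in>V k - {l}. x k j)"
          using V_finite[OF k(1)] k(2) by (rule sum.remove)
        moreover have "0 \<le> d * x k l" using pos[OF k(2)] d by simp
        moreover have "(\<Sum>j\<in>V k - {l}. x k j * (- d)) = - (d * (\<Sum>j\<in>V k - {l}. x k j))"
          by (simp add: sum_distrib_left sum_negf mult.commute)
        ultimately show ?thesis by (simp add: distrib_left)
      qed
      ultimately have "x k l * (v l - v k) \<le> ham_zero_bound + c k + d * (\<Sum>j\<in>V k. x k j)"
        using gen[OF v(1,2) k(1)] by linarith
      then have "v l - v k \<le> (ham_zero_bound + c k + d * (\<Sum>j\<in>V k. x k j)) / x k l"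
        using pos[OF k(2)] by (simp add: pos_le_divide_eq mult.commute)
      then show ?thesis using vk unfolding d'_def by linarith
    qed
    moreover have "0 \<le> d'" using d by (simp add: d'_def)
    moreover have "l \<in> {1..N}" using k V_subset[OF k(1)] by auto
    ultimately show ?case by blast
  qed
  define P where "P i k d \<longleftrightarrow> 0 \<le> d \<and> (\<forall>r v. 0 < r \<longrightarrow> stationary_solution r v \<longrightarrow>
      (\<forall>j\<in>{1..N}. v i \<le> v j) \<longrightarrow> v k \<le> v i + d)" for i k d
  have "\<exists>d. P i k d" if "i \<in> {1..N}" "k \<in> {1..N}" for i k
  proof -
    have "(i, k) \<in> {(k, l). k \<in> {1..N} \<and> l \<in> V k}\<^sup>*"
      using graph that unfolding strongly_connected_graph_def by blast
    from path[OF this that(1)] show ?thesis unfolding P_def by blast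
  qed
  then obtain d where P: "\<And>i k. i \<in> {1..N} \<Longrightarrow> k \<in> {1..N} \<Longrightarrow> P i k (d i k)"
    by metis
  have d: "0 \<le> d i k" "0 < r \<Longrightarrow> stationary_solution r v \<Longrightarrow>
      (\<forall>j\<in>{1..N}. v i \<le> v j) \<Longrightarrow> v k \<le> v i + d i k"
    if "i \<in> {1..N}" "k \<in> {1..N}" for i k r v
    using P[OF that] unfolding P_def by blast+
  \<comment> \<open>The minimising node varies with \<open>r\<close> and \<open>v\<close>. Summing
    the non-negative constants over all pairs covers every choice of it.\<close>
  have "v k - v i \<le> (\<Sum>i\<in>{1..N}. \<Sum>k\<in>{1..N}. d i k)"
    if v: "0 < r" "stationary_solution r v" and ik: "i \<in> {1..N}" "k \<in> {1..N}" for r v i k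
  proof -
    obtain m where m: "m \<in> {1..N}" "\<And>j. j \<in> {1..N} \<Longrightarrow> - v j \<le> - v m"
      using obtains_argmax[of "{1..N}" "\<lambda>j. - v j"] nodes by auto
    then have "v k \<le> v m + d m k" using d(2)[OF m(1) ik(2) v] by auto
    moreover have "v m \<le> v i" using m ik by auto
    moreover have "d m k \<le> (\<Sum>k\<in>{1..N}. d m k)"
      using d(1) m ik by (intro member_le_sum) auto
    moreover have "(\<Sum>k\<in>{1..N}. d m k) \<le> (\<Sum>i\<in>{1..N}. \<Sum>k\<in>{1..N}. d i k)"
      using d(1) m by (intro member_le_sum[of m]) (auto intro!: sum_nonneg)
    ultimately show ?thesis by linarith
  qed
  then show ?thesis by blast
qed

text \<open>The statement concerns an arbitrary family of solutions of the discounted equations,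
  which separates the limit r \<rightarrow> 0 from the probabilistic meaning of
  \<open>u\<close>.\<close>

lemma ergodic_limit:
  assumes u: "\<And>r. 0 < r \<Longrightarrow> stationary_solution r (u r)"
  shows "\<exists>\<gamma>::real.
      (\<forall>i\<in>{1..N}. ((\<lambda>r. r * u r i) \<longlongrightarrow> \<gamma>) (at_right 0)) \<and>
      (\<exists>\<rho>::nat \<Rightarrow> real. (\<forall>n. 0 < \<rho> n) \<and> \<rho> \<longlonglongrightarrow> 0 \<and>
         (\<forall>i\<in>{1..N}. convergent (\<lambda>n. u (\<rho> n) i - u (\<rho> n) 1))) \<and>
      (\<forall>(\<rho>::nat \<Rightarrow> real) (\<xi>::nat \<Rightarrow> real).
         (\<forall>n. 0 < \<rho> n) \<and> \<rho> \<longlonglongrightarrow> 0 \<and>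
         (\<forall>i\<in>{1..N}. (\<lambda>n. u (\<rho> n) i - u (\<rho> n) 1) \<longlonglongrightarrow> \<xi> i) \<longrightarrow>
         (\<forall>i\<in>{1..N}. - ereal \<gamma> + hamiltonian V L i (\<lambda>j. \<xi> j - \<xi> i) = 0))"
proof -
  obtain D where D: "\<And>r i k. 0 < r \<Longrightarrow> i \<in> {1..N} \<Longrightarrow> k \<in> {1..N} \<Longrightarrow> u r k - u r i \<le> D"
    using stationary_solution_oscillation u by blast
  have one: "1 \<in> {1..N}" using nodes by simp
  have D0: "0 \<le> D" using D[of 1 1 1] one by simp
  have limit_eq: "ham i (\<lambda>j. \<xi> j - \<xi> i) = \<gamma>"
    if \<rho>: "\<And>n. 0 < \<rho> n" "\<rho> \<longlonglongrightarrow> 0" and \<xi>: "\<And>i. i \<in> {1..N} \<Longrightarrow> (\<lambda>n. u (\<rho> n) i - u (\<rho> n) 1) \<longlonglongrightarrow> \<xi> i"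
      and \<gamma>: "(\<lambda>n. \<rho> n * u (\<rho> n) 1) \<longlonglongrightarrow> \<gamma>" and i: "i \<in> {1..N}" for \<rho> \<xi> \<gamma> i
  proof (rule LIMSEQ_unique)
    show "(\<lambda>n. ham i (\<lambda>j. u (\<rho> n) j - u (\<rho> n) i)) \<longlonglongrightarrow> ham i (\<lambda>j. \<xi> j - \<xi> i)"
    proof (rule ham_tendsto[OF i])
      fix j assume "j \<in> V i"
      then have "j \<in> {1..N}" using V_subset[OF i] by auto
      from tendsto_diff[OF \<xi>[OF this] \<xi>[OF i]]
      show "(\<lambda>n. u (\<rho> n) j - u (\<rho> n) i) \<longlonglongrightarrow> \<xi> j - \<xi> i" by simp
    qed
    \<comment> \<open>The increments converge, so multiplying them by \<open>\<rho> n\<close> gives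
      0 in the limit; every node therefore sees the same constant as node 1.\<close>
    have "(\<lambda>n. \<rho> n * u (\<rho> n) 1 + \<rho> n * (u (\<rho> n) i - u (\<rho> n) 1)) \<longlonglongrightarrow> \<gamma> + 0 * \<xi> i"
      by (intro tendsto_intros \<gamma> \<rho> \<xi> i)
    moreover have "\<rho> n * u (\<rho> n) 1 + \<rho> n * (u (\<rho> n) i - u (\<rho> n) 1) = ham i (\<lambda>j. u (\<rho> n) j - u (\<rho> n) i)" for n
      using u[OF \<rho>(1)[of n]] i by (simp add: stationary_solution_def algebra_simps)
    ultimately show "(\<lambda>n. ham i (\<lambda>j. u (\<rho> n) j - u (\<rho> n) i)) \<longlonglongrightarrow> \<gamma>" by simp
  qed
  define \<rho>0 where "\<rho>0 n = inverse (real (Suc n))" for n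
  \<comment> \<open>The index 0 is not a node, so it can carry the scaled value at node 1; a single
    extraction then handles it together with all increments.\<close>
  define f where "f n i = (if i = 0 then \<rho>0 n * u (\<rho>0 n) 1 else u (\<rho>0 n) i - u (\<rho>0 n) 1)" for n i
  have pos0: "0 < \<rho>0 n" for n by (simp add: \<rho>0_def)
  have "\<exists>s. strict_mono s \<and> (\<forall>i\<in>{0..N}. convergent (\<lambda>n. f (s n) i))"
  proof (rule finite_family_convergent_subsequence)
    fix i assume i: "i \<in> {0..N}"
    have "norm (f n i) \<le> max ham_zero_bound D" for n
    proof (cases "i = 0")
      case True
      then show ?thesis
        using stationary_solution_bound[OF u[OF pos0] pos0 one, of n] by (simp add: f_def le_max_iff_disj)
    next
      case False
      then have "i \<in> {1..N}" using i by auto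
      then show ?thesis
        using D[OF pos0 one, of i n] D[OF pos0 _ one, of i n] False
        by (auto simp: f_def le_max_iff_disj abs_le_iff)
    qed
    then show "bounded (range (\<lambda>n. f n i))" by (auto simp: bounded_iff)
  qed simp
  then obtain s where s: "strict_mono s" "\<And>i. i \<le> N \<Longrightarrow> convergent (\<lambda>n. f (s n) i)" by auto
  define \<rho> where "\<rho> n = \<rho>0 (s n)" for n
  have \<rho>: "0 < \<rho> n" for n by (simp add: \<rho>_def pos0)
  have "\<rho>0 \<longlonglongrightarrow> 0" unfolding \<rho>0_def by (rule LIMSEQ_inverse_real_of_nat)
  then have \<rho>lim: "\<rho> \<longlonglongrightarrow> 0"
    using LIMSEQ_subseq_LIMSEQ[OF _ s(1), of \<rho>0 0] by (simp add: \<rho>_def[abs_def] o_def)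
  have conv: "convergent (\<lambda>n. u (\<rho> n) i - u (\<rho> n) 1)" if "i \<in> {1..N}" for i
    using s(2)[of i] that by (simp add: f_def \<rho>_def)
  have "convergent (\<lambda>n. \<rho> n * u (\<rho> n) 1)"
    using s(2)[of 0] by (simp add: f_def \<rho>_def)
  then obtain \<gamma> where \<gamma>: "(\<lambda>n. \<rho> n * u (\<rho> n) 1) \<longlonglongrightarrow> \<gamma>" by (auto simp: convergent_def)
  define \<xi> where "\<xi> i = lim (\<lambda>n. u (\<rho> n) i - u (\<rho> n) 1)" for i
  have \<xi>: "(\<lambda>n. u (\<rho> n) i - u (\<rho> n) 1) \<longlonglongrightarrow> \<xi> i" if "i \<in> {1..N}" for i
    using conv[OF that] by (simp add: \<xi>_def convergent_LIMSEQ_iff)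
  have erg: "ham i (\<lambda>j. \<xi> j - \<xi> i) = \<gamma>" if "i \<in> {1..N}" for i
    by (rule limit_eq[OF \<rho> \<rho>lim \<xi> \<gamma> that])
  text \<open>Comparison with the ergodic pair where \<open>u r - \<xi>\<close> is extremal.\<close>
  have rate: "\<bar>r * u r k - \<gamma>\<bar> \<le> r * D" if r: "0 < r" and k: "k \<in> {1..N}" for r k
  proof -
    obtain a where a: "a \<in> {1..N}" "\<And>j. j \<in> {1..N} \<Longrightarrow> u r j - \<xi> j \<le> u r a - \<xi> a"
      using obtains_argmax[of "{1..N}" "\<lambda>j. u r j - \<xi> j"] nodes by auto
    obtain b where b: "b \<in> {1..N}" "\<And>j. j \<in> {1..N} \<Longrightarrow> \<xi> j - u r j \<le> \<xi> b - u r b"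
      using obtains_argmax[of "{1..N}" "\<lambda>j. \<xi> j - u r j"] nodes by auto
    have "r * u r a = ham a (\<lambda>j. u r j - u r a)"
      using u[OF r] a by (simp add: stationary_solution_def)
    also have "\<dots> \<le> ham a (\<lambda>j. \<xi> j - \<xi> a)"
    proof (rule ham_mono[OF a(1)])
      fix j assume "j \<in> V a"
      then show "u r j - u r a \<le> \<xi> j - \<xi> a" using a(2)[of j] V_subset[OF a(1)] by auto
    qed
    finally have ra: "r * u r a \<le> \<gamma>" using erg[OF a(1)] by simp
    have "ham b (\<lambda>j. \<xi> j - \<xi> b) \<le> ham b (\<lambda>j. u r j - u r b)"
    proof (rule ham_mono[OF b(1)])
      fix j assume "j \<in> V b"
      then show "\<xi> j - \<xi> b \<le> u r j - u r b" using b(2)[of j] V_subset[OF b(1)] by auto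
    qed
    also have "\<dots> = r * u r b"
      using u[OF r] b by (simp add: stationary_solution_def)
    finally have rb: "\<gamma> \<le> r * u r b" using erg[OF b(1)] by simp
    \<comment> \<open>The two extremal nodes bound \<gamma> from opposite sides; the oscillation
      bound carries both estimates to \<open>k\<close> at a cost of \<open>r * D\<close>.\<close>
    have "r * (u r k - u r a) \<le> r * D" "r * (u r b - u r k) \<le> r * D"
      using D[OF r a(1) k] D[OF r k b(1)] r by auto
    then show ?thesis using ra rb by (simp add: abs_le_iff algebra_simps)
  qed
  have lim: "((\<lambda>r. r * u r i) \<longlongrightarrow> \<gamma>) (at_right 0)" if i: "i \<in> {1..N}" for i
  proof (rule Lim_null_comparison[THEN LIM_zero_cancel])
    show "eventually (\<lambda>r. norm (r * u r i - \<gamma>) \<le> r * D) (at_right 0)"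
      using rate[OF _ i] by (auto intro: eventually_at_right_less[THEN eventually_mono])
    have "((\<lambda>r. r * D) \<longlongrightarrow> 0 * D) (at_right 0)" by (intro tendsto_intros)
    then show "((\<lambda>r. r * D) \<longlongrightarrow> 0) (at_right 0)" by simp
  qed
  have "- ereal \<gamma> + hamiltonian V L i (\<lambda>j. \<zeta> j - \<zeta> i) = 0"
    if "\<forall>n. 0 < \<sigma> n" "\<sigma> \<longlonglongrightarrow> 0" "\<forall>i\<in>{1..N}. (\<lambda>n. u (\<sigma> n) i - u (\<sigma> n) 1) \<longlonglongrightarrow> \<zeta> i" "i \<in> {1..N}"
    for \<sigma> :: "nat \<Rightarrow> real" and \<zeta> i
  proof -
    \<comment> \<open>For an arbitrary sequence the constant is already known from the limit of the
      full family, so \<open>limit_eq\<close> applies with the same \<gamma>.\<close>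
    have "\<forall>n. \<sigma> n \<noteq> 0" using that(1) by (metis less_irrefl)
    then have "filterlim \<sigma> (at_right 0) sequentially"
      using that(1,2) by (simp add: filterlim_at)
    then have "(\<lambda>n. \<sigma> n * u (\<sigma> n) 1) \<longlonglongrightarrow> \<gamma>"
      by (rule filterlim_compose[OF lim[OF one]])
    then have "ham i (\<lambda>j. \<zeta> j - \<zeta> i) = \<gamma>"
      using that by (intro limit_eq[of \<sigma> \<zeta> \<gamma> i]) auto
    then show ?thesis using that(4) by (simp add: hamiltonian_eq)
  qed
  then show ?thesis using lim \<rho> \<rho>lim conv by (intro exI[of _ \<gamma>]) blast
qed

end

section \<open>Verification: value functions converge to the stationary solution\<close>

text \<open>The non-negative integral is monotone on arbitrary functions. Payoffs can thus be
  compared pointwise, without first showing that the running cost along the chain is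
  measurable.\<close>

lemma ereal_integral_mono:
  assumes "\<And>x. x \<in> space M \<Longrightarrow> f x \<le> g x"
  shows "ereal_integral M f \<le> ereal_integral M g"
proof -
  have "(\<integral>\<^sup>+ x. e2ennreal (f x) \<partial>M) \<le> (\<integral>\<^sup>+ x. e2ennreal (g x) \<partial>M)"
    using assms by (intro nn_integral_mono e2ennreal_mono)
  moreover have "(\<integral>\<^sup>+ x. e2ennreal (- g x) \<partial>M) \<le> (\<integral>\<^sup>+ x. e2ennreal (- f x) \<partial>M)"
    using assms by (intro nn_integral_mono e2ennreal_mono) simp
  ultimately show ?thesis
    unfolding ereal_integral_def by (intro ereal_minus_mono) (simp_all add: less_eq_ennreal.rep_eq[symmetric])
qed

lemma ereal_integral_ereal:
  assumes "integrable M f"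
  shows "ereal_integral M (\<lambda>x. ereal (f x)) = ereal (LINT x|M. f x)"
proof -
  have fin: "(\<integral>\<^sup>+ x. ennreal (f x) \<partial>M) < top" "(\<integral>\<^sup>+ x. ennreal (- f x) \<partial>M) < top"
    using assms by (auto simp: real_integrable_def less_top)
  have e: "enn2ereal a = ereal (enn2real a)" if "a < top" for a
    using that by (cases a) auto
  show ?thesis
    unfolding ereal_integral_def using e[OF fin(1)] e[OF fin(2)]
    by (simp add: real_lebesgue_integral_def[OF assms])
qed

context controlled_graph
begin

text \<open>This is Fenchel's inequality, solved for the cost; \<open>restrict\<close> places the
  rates in the extensional space on which the supremum is taken.\<close>

lemma L_ge_hamiltonian:
  assumes m: "m \<in> {1..N}" and "\<And>j. j \<in> V m \<Longrightarrow> 0 \<le> x j"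
  shows "ereal ((\<Sum>j\<in>V m. x j * p j) - ham m p) \<le> L m (restrict x (V m))"
proof -
  have r: "restrict x (V m) \<in> rate_space V m"
    using assms(2) by (auto simp: rate_space_def)
  show ?thesis
  proof (cases "L m (restrict x (V m))")
    case (real c)
    then show ?thesis using ham_ge[OF m r real, of p] by simp
  next
    case MInf
    then show ?thesis using L_not_MInf[OF m r] by simp
  qed simp
qed

text \<open>With \<open>a\<close> in place of the true running cost, the Dynkin formula computes the
  payoff exactly as \<open>J\<close>. A one-sided bound between cost and \<open>a\<close> therefore
  bounds the payoff, and the last claim controls the mismatch between \<open>g\<close> and
  \<open>v\<close> at time \<open>T\<close> uniformly in the control.\<close>

lemma payoff_compare:
  fixes M :: "'w measure" and v g :: "nat \<Rightarrow> real" and r :: real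
  assumes u: "usual_conditions M F" and Y: "markov_chain_with_rates N V M F t T i l Y"
    and t: "0 \<le> t" "t \<le> T" and i: "i \<in> {1..N}" and l: "l \<in> admissible N V t T"
  defines "a \<equiv> \<lambda>s m. (\<Sum>j\<in>V m. l s m j * (v j - v m)) - r * v m"
    and "J \<equiv> ereal (v i + exp (- r * (T - t)) * (LINT w|M. g (Y T w) - v (Y T w)))"
  shows "(\<And>s m. s \<in> {t..T} \<Longrightarrow> m \<in> {1..N} \<Longrightarrow> ereal (a s m) \<le> L m (restrict (l s m) (V m))) \<Longrightarrow>
      payoff V L g M r t T l Y \<le> J"
    and "(\<And>s m. s \<in> {t..T} \<Longrightarrow> m \<in> {1..N} \<Longrightarrow> L m (restrict (l s m) (V m)) \<le> ereal (a s m)) \<Longrightarrow>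
      J \<le> payoff V L g M r t T l Y"
    and "\<bar>LINT w|M. g (Y T w) - v (Y T w)\<bar> \<le> (\<Sum>m=1..N. \<bar>g m - v m\<bar>)"
proof -
  interpret prob_space M using usual_conditions_subalgebra[OF u, of 0] by simp
  define B where "B = restrict_space lborel {t..T}"
  have spB: "space B = {t..T}" by (simp add: B_def space_restrict_space)
  have YT: "Y T \<in> M \<rightarrow>\<^sub>M count_space {1..N}"
    by (rule chain_measurable[OF u Y t(1)]) (use t in auto)
  have YN: "Y s w \<in> {1..N}" if "s \<in> {t..T}" "w \<in> space M" for s w
    using measurable_space[OF chain_measurable[OF u Y t(1) that(1)] that(2)] by simp
  have le_sum: "\<bar>f m\<bar> \<le> (\<Sum>m=1..N. \<bar>f m\<bar>)" if "m \<in> {1..N}" for f :: "nat \<Rightarrow> real" and m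
    using that by (intro member_le_sum) auto
  have fint: "integrable M (\<lambda>w. f (Y T w))" for f :: "nat \<Rightarrow> real"
  proof (rule integrable_const_bound[where B="\<Sum>m=1..N. \<bar>f m\<bar>"])
    show "AE w in M. norm (f (Y T w)) \<le> (\<Sum>m=1..N. \<bar>f m\<bar>)"
      using le_sum[of _ f] YN[of T] t by (intro AE_I2) simp
    show "(\<lambda>w. f (Y T w)) \<in> borel_measurable M"
      by (rule measurable_compose[OF YT]) simp
  qed
  have "\<bar>LINT w|M. g (Y T w) - v (Y T w)\<bar> \<le> (LINT w|M. \<bar>g (Y T w) - v (Y T w)\<bar>)"
    by (rule integral_abs_bound)
  also have "\<dots> \<le> (LINT w|M. (\<Sum>m=1..N. \<bar>g m - v m\<bar>))"
    using fint[of "\<lambda>m. \<bar>g m - v m\<bar>"] le_sum[of _ "\<lambda>m. g m - v m"] YN[of T] t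
    by (intro integral_mono) auto
  finally show "\<bar>LINT w|M. g (Y T w) - v (Y T w)\<bar> \<le> (\<Sum>m=1..N. \<bar>g m - v m\<bar>)"
    by (simp add: prob_space)
  define A where "A w = (LINT s|B. exp (- r * (s - t)) * a s (Y s w))" for w
  have dyn1: "integrable B (\<lambda>s. exp (- r * (s - t)) * a s (Y s w))" if "w \<in> space M" for w
    unfolding a_def B_def by (rule chain_dynkin(1)[OF u Y t i l V_subset]) (use that in auto)
  have dyn2: "integrable M A"
    unfolding A_def a_def B_def by (rule chain_dynkin(2)[OF u Y t i l V_subset])
  have dyn3: "(LINT w|M. A w) = exp (- r * (T - t)) * (LINT w|M. v (Y T w)) - v i"
    unfolding A_def a_def B_def by (rule chain_dynkin(3)[OF u Y t i l V_subset])
  \<comment> \<open>\<open>Z\<close> is the true discounted cost along a path and \<open>A\<close>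
    its surrogate.\<close>
  define Z where "Z w = ereal_integral B
    (\<lambda>s. ereal (exp (- r * (s - t))) * L (Y s w) (restrict (l s (Y s w)) (V (Y s w))))" for w
  have pay: "payoff V L g M r t T l Y =
      ereal_integral M (\<lambda>w. - Z w + ereal (exp (- r * (T - t)) * g (Y T w)))"
    by (simp add: payoff_def Z_def B_def)
  have Aint: "ereal (A w) = ereal_integral B (\<lambda>s. ereal (exp (- r * (s - t))) * ereal (a s (Y s w)))"
    if "w \<in> space M" for w
    using ereal_integral_ereal[OF dyn1[OF that]] by (simp add: A_def)
  have "ereal_integral M (\<lambda>w. ereal (- A w + exp (- r * (T - t)) * g (Y T w))) =
      ereal (LINT w|M. - A w + exp (- r * (T - t)) * g (Y T w))"
    by (rule ereal_integral_ereal) (use dyn2 fint[of g] in auto)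
  also have "(LINT w|M. - A w + exp (- r * (T - t)) * g (Y T w)) =
      v i + exp (- r * (T - t)) * (LINT w|M. g (Y T w) - v (Y T w))"
    using dyn2 fint[of g] fint[of v] dyn3 by (simp add: algebra_simps)
  finally have J: "ereal_integral M (\<lambda>w. ereal (- A w + exp (- r * (T - t)) * g (Y T w))) = J"
    by (simp add: J_def)
  show "payoff V L g M r t T l Y \<le> J"
    if le: "\<And>s m. s \<in> {t..T} \<Longrightarrow> m \<in> {1..N} \<Longrightarrow> ereal (a s m) \<le> L m (restrict (l s m) (V m))"
    unfolding pay J[symmetric]
  proof (rule ereal_integral_mono)
    fix w assume w: "w \<in> space M"
    have "ereal (A w) \<le> Z w"
      unfolding Aint[OF w] Z_def
      by (intro ereal_integral_mono ereal_mult_left_mono le YN w) (simp_all add: spB)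
    then have "- Z w \<le> - ereal (A w)" by (simp only: ereal_minus_le_minus)
    then have "- Z w + ereal (exp (- r * (T - t)) * g (Y T w))
        \<le> - ereal (A w) + ereal (exp (- r * (T - t)) * g (Y T w))" by (rule add_right_mono)
    then show "- Z w + ereal (exp (- r * (T - t)) * g (Y T w))
        \<le> ereal (- A w + exp (- r * (T - t)) * g (Y T w))" by simp
  qed
  show "J \<le> payoff V L g M r t T l Y"
    if le: "\<And>s m. s \<in> {t..T} \<Longrightarrow> m \<in> {1..N} \<Longrightarrow> L m (restrict (l s m) (V m)) \<le> ereal (a s m)"
    unfolding pay J[symmetric]
  proof (rule ereal_integral_mono)
    fix w assume w: "w \<in> space M"
    have "Z w \<le> ereal (A w)"
      unfolding Aint[OF w] Z_def
      by (intro ereal_integral_mono ereal_mult_left_mono le YN w) (simp_all add: spB)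
    then have "- ereal (A w) \<le> - Z w" by (simp only: ereal_minus_le_minus)
    then have "- ereal (A w) + ereal (exp (- r * (T - t)) * g (Y T w))
        \<le> - Z w + ereal (exp (- r * (T - t)) * g (Y T w))" by (rule add_right_mono)
    then show "ereal (- A w + exp (- r * (T - t)) * g (Y T w))
        \<le> - Z w + ereal (exp (- r * (T - t)) * g (Y T w))" by simp
  qed
qed

text \<open>For the lower bound, shifting \<open>v\<close> down by a constant \<open>e'\<close> absorbs the error \<open>r e'\<close> of the
  near-maximisers of the Hamiltonian, which serve as constant controls.\<close>

lemma value_fun_tendsto:
  fixes M :: "'w measure" and v :: "nat \<Rightarrow> real"
  assumes u: "usual_conditions M F"
    and chains: "\<And>T t i l. \<lbrakk>0 \<le> t; t \<le> T; i \<in> {1..N}; l \<in> admissible N V t T\<rbrakk>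
                   \<Longrightarrow> markov_chain_with_rates N V M F t T i l (X T t i l)"
    and r: "0 < r" and v: "stationary_solution r v" and i: "i \<in> {1..N}" and t: "0 \<le> t"
  shows "((\<lambda>T. value_fun N V L g M X T r i t) \<longlongrightarrow> ereal (v i)) at_top"
proof -
  define C where "C = (\<Sum>m=1..N. \<bar>g m - v m\<bar>)"
  have "((\<lambda>T. exp (- r * (T - t)) * C) \<longlongrightarrow> 0) at_top"
  proof -
    have "filterlim (\<lambda>T. - t + T) at_top at_top"
      by (rule filterlim_tendsto_add_at_top[OF tendsto_const filterlim_ident])
    then have "filterlim (\<lambda>T. r * (T - t)) at_top at_top"
      using filterlim_tendsto_pos_mult_at_top[OF tendsto_const r] by simp
    then have "filterlim (\<lambda>T. - r * (T - t)) at_bot at_top"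
      by (simp add: filterlim_uminus_at_bot)
    then have "((\<lambda>T. exp (- r * (T - t))) \<longlongrightarrow> 0) at_top"
      by (rule filterlim_compose[OF exp_at_bot])
    then show ?thesis by (rule tendsto_mult_left_zero)
  qed
  from tendsto_add[OF tendsto_const this] tendsto_diff[OF tendsto_const this]
  have lim_up: "((\<lambda>T. ereal (v i + exp (- r * (T - t)) * C)) \<longlongrightarrow> ereal (v i)) at_top"
    and lim_lo: "((\<lambda>T. ereal (v i - exp (- r * (T - t)) * C)) \<longlongrightarrow> ereal (v i)) at_top"
    by simp_all
  have up: "eventually (\<lambda>T. value_fun N V L g M X T r i t \<le> ereal (v i + exp (- r * (T - t)) * C)) at_top"
    using eventually_ge_at_top[of t]
  proof eventually_elim
    case (elim T)
    show ?case unfolding value_fun_def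
    proof (rule SUP_least)
      fix l assume l: "l \<in> admissible N V t T"
      note cmp = payoff_compare[OF u chains[OF t elim i l] t elim i l]
      have "payoff V L g M r t T l (X T t i l) \<le>
          ereal (v i + exp (- r * (T - t)) * (LINT w|M. g (X T t i l T w) - v (X T t i l T w)))"
      proof (rule cmp(1)[where r=r and v=v and g=g])
        fix s m assume sm: "s \<in> {t..T}" "m \<in> {1..N}"
        then have "0 \<le> l s m j" if "j \<in> V m" for j
          using l that by (simp add: admissible_def)
        \<comment> \<open>For this \<open>p\<close> the stationary equation replaces the Hamiltonian
          by \<open>r * v m\<close>, so \<open>a\<close> bounds the cost of every control from
          below.\<close>
        from L_ge_hamiltonian[OF sm(2) this, where p="\<lambda>j. v j - v m"]
        show "ereal ((\<Sum>j\<in>V m. l s m j * (v j - v m)) - r * v m) \<le> L m (restrict (l s m) (V m))"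
          using v sm(2) by (simp add: stationary_solution_def)
      qed
      also have "\<dots> \<le> ereal (v i + exp (- r * (T - t)) * C)"
        using cmp(3)[of g v] by (auto simp: C_def abs_le_iff)
      finally show "payoff V L g M r t T l (X T t i l) \<le> ereal (v i + exp (- r * (T - t)) * C)" .
    qed
  qed
  have lo: "eventually (\<lambda>T. ereal (v i - exp (- r * (T - t)) * C) \<le> value_fun N V L g M X T r i t) at_top"
    using eventually_ge_at_top[of t]
  proof eventually_elim
    case (elim T)
    show ?case
    proof (rule ereal_le_epsilon2)
      fix e :: real assume e: "0 < e"
      \<comment> \<open>The shift by \<open>e'\<close> lowers the value at \<open>i\<close> by
        \<open>e'\<close> and raises the terminal mismatch by at most \<open>N * e'\<close>, which
        adds up to \<open>e\<close>.\<close>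
      define e' where "e' = e / (1 + N)"
      have e': "0 < e'" using e by (simp add: e'_def)
      define near_max where "near_max m x c \<longleftrightarrow> x \<in> rate_space V m \<and> L m x = ereal c \<and>
          ham m (\<lambda>j. v j - v m) - r * e' < (\<Sum>j\<in>V m. x j * (v j - v m)) - c" for m x c
      have "\<exists>x c. near_max m x c" if "m \<in> {1..N}" for m
        by (rule ham_approx[OF that mult_pos_pos[OF r e'], of "\<lambda>j. v j - v m"])
           (auto simp: near_max_def)
      then obtain x c where xc: "\<And>m. m \<in> {1..N} \<Longrightarrow> near_max m (x m) (c m)"
        by metis
      have x: "x m \<in> rate_space V m" and c: "L m (x m) = ereal (c m)"
        and near: "ham m (\<lambda>j. v j - v m) - r * e' < (\<Sum>j\<in>V m. x m j * (v j - v m)) - c m"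
        if "m \<in> {1..N}" for m
        using xc[OF that] unfolding near_max_def by blast+
      define l where "l = (\<lambda>s::real. x)"
      have "integrable lborel (indicat_real {t..T})"
        by (rule integrable_real_indicator) (auto simp: emeasure_lborel_Icc_eq)
      then have l: "l \<in> admissible N V t T"
        using x by (auto simp: l_def admissible_def rate_space_def PiE_iff set_integrable_def)
      define v' where "v' m = v m - e'" for m
      note cmp = payoff_compare[OF u chains[OF t elim i l] t elim i l]
      have "ereal (v' i + exp (- r * (T - t)) * (LINT w|M. g (X T t i l T w) - v' (X T t i l T w)))
          \<le> payoff V L g M r t T l (X T t i l)"
      proof (rule cmp(2)[where r=r and v=v' and g=g])
        fix s m assume m: "m \<in> {1..N}"
        \<comment> \<open>A constant shift leaves all differences unchanged and adds
          \<open>r * e'\<close> to the discount term, exactly the slack allowed to the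
          near-maximiser.\<close>
        have "restrict (l s m) (V m) = x m"
          using x[OF m] by (auto simp: l_def rate_space_def PiE_iff extensional_restrict)
        then show "L m (restrict (l s m) (V m)) \<le> ereal ((\<Sum>j\<in>V m. l s m j * (v' j - v' m)) - r * v' m)"
          using near[OF m] c[OF m] v m by (simp add: l_def v'_def stationary_solution_def algebra_simps)
      qed
      also have "\<dots> \<le> value_fun N V L g M X T r i t"
        unfolding value_fun_def using l by (rule SUP_upper)
      finally have le: "ereal (v' i + exp (- r * (T - t)) * (LINT w|M. g (X T t i l T w) - v' (X T t i l T w)))
          \<le> value_fun N V L g M X T r i t" .
      have "(\<Sum>m=1..N. \<bar>g m - v' m\<bar>) \<le> (\<Sum>m=1..N. \<bar>g m - v m\<bar> + e')"
        unfolding v'_def using e' by (intro sum_mono) auto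
      then have "(\<Sum>m=1..N. \<bar>g m - v' m\<bar>) \<le> C + N * e'"
        by (simp add: sum.distrib C_def)
      then have "exp (- r * (T - t)) * \<bar>LINT w|M. g (X T t i l T w) - v' (X T t i l T w)\<bar>
          \<le> exp (- r * (T - t)) * (C + N * e')"
        using cmp(3)[of g v'] by (intro mult_left_mono) auto
      also have "\<dots> \<le> exp (- r * (T - t)) * C + N * e'"
        using r elim e' by (simp add: distrib_left mult_left_le_one_le)
      finally have "exp (- r * (T - t)) * \<bar>LINT w|M. g (X T t i l T w) - v' (X T t i l T w)\<bar>
          \<le> exp (- r * (T - t)) * C + N * e'" .
      moreover have "- (exp (- r * (T - t)) * \<bar>LINT w|M. g (X T t i l T w) - v' (X T t i l T w)\<bar>)
          \<le> exp (- r * (T - t)) * (LINT w|M. g (X T t i l T w) - v' (X T t i l T w))"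
        unfolding mult_minus_right[symmetric] by (intro mult_left_mono) auto
      moreover have "e' + N * e' = e"
      proof -
        have "1 + real N \<noteq> 0" by linarith
        then have "(1 + real N) * e' = e" by (simp add: e'_def)
        then show ?thesis by (simp add: distrib_right)
      qed
      ultimately have "v i - exp (- r * (T - t)) * C \<le>
          v' i + exp (- r * (T - t)) * (LINT w|M. g (X T t i l T w) - v' (X T t i l T w)) + e"
        unfolding v'_def by linarith
      then have "ereal (v i - exp (- r * (T - t)) * C) \<le>
          ereal (v' i + exp (- r * (T - t)) * (LINT w|M. g (X T t i l T w) - v' (X T t i l T w))) + ereal e"
        by simp
      also have "\<dots> \<le> value_fun N V L g M X T r i t + ereal e"
        using le by (rule add_right_mono)
      finally show "ereal (v i - exp (- r * (T - t)) * C) \<le> value_fun N V L g M X T r i t + ereal e" .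
    qed
  qed
  show ?thesis by (rule tendsto_sandwich[OF lo up lim_lo lim_up])
qed

end

section \<open>Identification of the stationary value and conclusion\<close>

theorem proposition5:
  fixes N :: nat
    and V :: "nat \<Rightarrow> nat set"
    and L :: "nat \<Rightarrow> (nat \<Rightarrow> real) \<Rightarrow> ereal"
    and g :: "nat \<Rightarrow> real"
    and M :: "'w measure"
    and F :: "real \<Rightarrow> 'w measure"
    and X :: "real \<Rightarrow> real \<Rightarrow> nat \<Rightarrow> (real \<Rightarrow> nat \<Rightarrow> nat \<Rightarrow> real) \<Rightarrow> real \<Rightarrow> 'w \<Rightarrow> nat"
  assumes N: "1 \<le> N"
    and graph: "strongly_connected_graph N V"
    and A1: "\<And>i. i \<in> {1..N} \<Longrightarrow> \<exists>x \<in> V i \<rightarrow>\<^sub>E {0<..}. L i x < \<infinity>"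
    and A2: "\<And>i. i \<in> {1..N} \<Longrightarrow> lsc_on (rate_space V i) (L i)"
    and A3: "\<exists>C::real. \<forall>i\<in>{1..N}. \<forall>x\<in>rate_space V i. ereal C \<le> L i x"
    and A4: "\<And>i. i \<in> {1..N} \<Longrightarrow> superlinear V i (L i)"
    and usual: "usual_conditions M F"
    and chains: "\<And>T t i l. \<lbrakk>0 \<le> t; t \<le> T; i \<in> {1..N}; l \<in> admissible N V t T\<rbrakk>
                   \<Longrightarrow> markov_chain_with_rates N V M F t T i l (X T t i l)"
  defines "u \<equiv> stationary_value N V L g M X"
  shows "\<exists>\<gamma>::real.
      (\<forall>i\<in>{1..N}. ((\<lambda>r. r * u r i) \<longlongrightarrow> \<gamma>) (at_right 0)) \<and>
      (\<exists>\<rho>::nat \<Rightarrow> real. (\<forall>n. 0 < \<rho> n) \<and> \<rho> \<longlonglongrightarrow> 0 \<and>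
         (\<forall>i\<in>{1..N}. convergent (\<lambda>n. u (\<rho> n) i - u (\<rho> n) 1))) \<and>
      (\<forall>(\<rho>::nat \<Rightarrow> real) (\<xi>::nat \<Rightarrow> real).
         (\<forall>n. 0 < \<rho> n) \<and> \<rho> \<longlonglongrightarrow> 0 \<and>
         (\<forall>i\<in>{1..N}. (\<lambda>n. u (\<rho> n) i - u (\<rho> n) 1) \<longlonglongrightarrow> \<xi> i) \<longrightarrow>
         (\<forall>i\<in>{1..N}. - ereal \<gamma> + hamiltonian V L i (\<lambda>j. \<xi> j - \<xi> i) = 0))"
proof -
  interpret controlled_graph N V L
    using N graph A1 A3 A4 by unfold_locales
  have "stationary_solution r (u r)" if r: "0 < r" for r
  proof -
    obtain v where v: "stationary_solution r v"
      using stationary_solution_exists[OF r] by blast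
    have "u r i = v i" if i: "i \<in> {1..N}" for i
      unfolding u_def stationary_value_def
    \<comment> \<open>Uniqueness of limits, used at the single time 0, determines the number
      selected by \<open>THE\<close>.\<close>
    proof (rule the_equality)
      show lim: "\<forall>t\<ge>0. ((\<lambda>T. value_fun N V L g M X T r i t) \<longlongrightarrow> ereal (v i)) at_top"
        using value_fun_tendsto[OF usual chains r v i] by blast
      fix c assume "\<forall>t\<ge>0. ((\<lambda>T. value_fun N V L g M X T r i t) \<longlongrightarrow> ereal c) at_top"
      then have "((\<lambda>T. value_fun N V L g M X T r i 0) \<longlongrightarrow> ereal c) at_top" by simp
      moreover have "((\<lambda>T. value_fun N V L g M X T r i 0) \<longlongrightarrow> ereal (v i)) at_top"
        using lim by simp
      ultimately have "ereal c = ereal (v i)"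
        by (rule tendsto_unique[OF trivial_limit_at_top_linorder])
      then show "c = v i" by simp
    qed
    \<comment> \<open>The functions \<open>u r\<close> and \<open>v\<close> agree only on the nodes,
      but successors are nodes; monotonicity in both directions acts as a congruence rule.\<close>
    then have "ham i (\<lambda>j. u r j - u r i) = ham i (\<lambda>j. v j - v i)" if "i \<in> {1..N}" for i
      using that V_subset[OF that] by (intro antisym ham_mono[OF that]) auto
    then show ?thesis
      using v \<open>\<And>i. i \<in> {1..N} \<Longrightarrow> u r i = v i\<close> by (simp add: stationary_solution_def)
  qed
  then show ?thesis by (rule ergodic_limit)
qed

end
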